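(* Let $\beta>0$, $\theta>0$, and let $W$ and $D$ satisfy the standing assumptions in the context. A probability density $\rho(u,x)$ on $[0,2\pi]\times[0,1]$ with Lebesgue marginal in $x$ is a stationary solution of the McKean-Vlasov equation $$\partial_t\rho(t,u,x)=\theta\,\partial_u\Big(\rho(t,u,x)\int_0^1\!\!\int_0^{2\pi}W(x,y)D'(u-v)\rho(t,v,y)\,dv\,dy\Big)+\beta^{-1}\partial_u^2\rho(t,u,x)$$ if and only if it is a critical point of the free energy $$\mathcal{F}(\rho)=\beta^{-1}\int_0^1\!\!\int_0^{2\pi}\rho\log\rho\,du\,dx+\frac\theta2\int_0^1\!\!\int_0^{2\pi}\!\!\int_0^1\!\!\int_0^{2\pi}W(x,y)D(u-v)\rho(u,x)\rho(v,y)\,du\,dx\,dv\,dy.$$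
   Context: Standing assumptions: $W:[0,1]^2\to[0,1]$ is symmetric and measurable and satisfies $\int_0^1|W(x_1,y)-W(x_2,y)|\,dy\to0$ as $|x_1-x_2|\to0$; $D$ is a Lipschitz continuous, even, $2\pi$-periodic function. The variable $u\in[0,2\pi]$ is periodic. Let $\mathcal{P}^L_2$ be the set of probability measures on $[0,2\pi]\times[0,1]$ whose marginal in $x$ is Lebesgue measure (with finite second moment in $u$, automatic here); a density $\rho$ in it satisfies $\int_0^{2\pi}\rho(u,x)\,du=1$ for a.e. $x$. A stationary solution is a density $\rho$ in $\mathcal{P}^L_2$ solving the equation (in the weak sense in $u$, for a.e. $x$) with $\partial_t\rho=0$. Convention: $0\log0=0$, and $\mathcal{F}$ may take the value $+\infty$. A density $\rho\in\mathcal{P}^L_2$ with $\mathcal{F}(\rho)<\infty$ is a critical point of $\mathcal{F}$ if for every density $\rho_1\in\mathcal{P}^L_2$ with $\mathcal{F}(\rho_1)<\infty$, setting $\rho_s=(1-s)\rho+s\rho_1$ for $s\in[0,1]$, one has $\frac{d}{ds}\mathcal{F}(\rho_s)\big|_{s=0}=0$ (one-sided derivative at $s=0$). *)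

theory Defs
  imports "HOL-Analysis.Analysis" "HOL-Probability.Probability"
begin

definition angle_measure :: "real measure" where
  "angle_measure = restrict_space lborel {0..2 * pi}"

definition label_measure :: "real measure" where
  "label_measure = restrict_space lborel {0..1}"

text \<open>A point of \<open>[0,2\<pi>] \<times> [0,1]\<close> is written \<open>(u, x)\<close>.\<close>

definition phase_measure :: "(real \<times> real) measure" where
  "phase_measure = angle_measure \<Otimes>\<^sub>M label_measure"

definition P2L :: "(real \<times> real) measure set" where
  "P2L = {M. sets M = sets phase_measure \<and> prob_space M \<and>
             distr M label_measure snd = label_measure \<and>
             integrable M (\<lambda>(u, x). u\<^sup>2)}"

definition P2L_density :: "(real \<times> real \<Rightarrow> real) \<Rightarrow> bool" where
  "P2L_density \<rho> \<longleftrightarrow>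
     \<rho> \<in> borel_measurable phase_measure \<and>
     (\<forall>z\<in>space phase_measure. 0 \<le> \<rho> z) \<and>
     density phase_measure (\<lambda>z. ennreal (\<rho> z)) \<in> P2L"

definition admissible_kernel :: "(real \<Rightarrow> real \<Rightarrow> real) \<Rightarrow> bool" where
  "admissible_kernel W \<longleftrightarrow>
     (\<lambda>(x, y). W x y) \<in> borel_measurable (restrict_space borel ({0..1} \<times> {0..1})) \<and>
     (\<forall>x\<in>{0..1}. \<forall>y\<in>{0..1}. 0 \<le> W x y \<and> W x y \<le> 1) \<and>
     (\<forall>x\<in>{0..1}. \<forall>y\<in>{0..1}. W x y = W y x) \<and>
     (\<forall>\<epsilon>>0. \<exists>\<delta>>0. \<forall>x1\<in>{0..1}. \<forall>x2\<in>{0..1}. \<bar>x1 - x2\<bar> < \<delta> \<longrightarrow>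
        (\<integral>y. \<bar>W x1 y - W x2 y\<bar> \<partial>label_measure) < \<epsilon>)"

definition admissible_potential :: "(real \<Rightarrow> real) \<Rightarrow> bool" where
  "admissible_potential D \<longleftrightarrow>
     (\<exists>L. L-lipschitz_on UNIV D) \<and> (\<forall>u. D (- u) = D u) \<and> (\<forall>u. D (u + 2 * pi) = D u)"

text \<open>A Lipschitz \<open>D\<close> is differentiable almost everywhere. Where it is not, \<^term>\<open>deriv D\<close> takes
  an unspecified constant value, which affects none of the integrals below.\<close>

definition drift ::
  "(real \<Rightarrow> real \<Rightarrow> real) \<Rightarrow> (real \<Rightarrow> real) \<Rightarrow> (real \<times> real \<Rightarrow> real) \<Rightarrow> real \<Rightarrow> real \<Rightarrow> real" where
  "drift W D \<rho> u x = (\<integral>(v, y). W x y * deriv D (u - v) * \<rho> (v, y) \<partial>phase_measure)"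

definition periodic_test_function :: "(real \<Rightarrow> real) \<Rightarrow> bool" where
  "periodic_test_function \<phi> \<longleftrightarrow>
     (\<forall>k::nat. (deriv ^^ k) \<phi> differentiable_on UNIV) \<and> (\<forall>u. \<phi> (u + 2 * pi) = \<phi> u)"

definition stationary_solution ::
  "real \<Rightarrow> real \<Rightarrow> (real \<Rightarrow> real \<Rightarrow> real) \<Rightarrow> (real \<Rightarrow> real) \<Rightarrow> (real \<times> real \<Rightarrow> real) \<Rightarrow> bool" where
  "stationary_solution \<beta> \<theta> W D \<rho> \<longleftrightarrow>
     P2L_density \<rho> \<and>
     (AE x in label_measure. \<forall>\<phi>. periodic_test_function \<phi> \<longrightarrow>
        - \<theta> * (\<integral>u. \<rho> (u, x) * drift W D \<rho> u x * deriv \<phi> u \<partial>angle_measure)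
        + inverse \<beta> * (\<integral>u. \<rho> (u, x) * deriv (deriv \<phi>) u \<partial>angle_measure) = 0)"

text \<open>The Bochner integral of a non-integrable function is \<open>0\<close>, so the entropy, which may be
  \<open>\<infinity>\<close>, is taken as the difference of the integrals of the positive and negative parts
  (\<^const>\<open>ennreal\<close> sends negative reals to \<open>0\<close>). Since \<open>r ln r \<ge> - 1 / e\<close>,
  the second one is finite. The convention \<open>0 ln 0 = 0\<close> holds in HOL.\<close>

definition extended_integral :: "'a measure \<Rightarrow> ('a \<Rightarrow> real) \<Rightarrow> ereal" where
  "extended_integral M f =
     enn2ereal (\<integral>\<^sup>+ z. ennreal (f z) \<partial>M) - enn2ereal (\<integral>\<^sup>+ z. ennreal (- f z) \<partial>M)"

definition free_energy ::
  "real \<Rightarrow> real \<Rightarrow> (real \<Rightarrow> real \<Rightarrow> real) \<Rightarrow> (real \<Rightarrow> real) \<Rightarrow> (real \<times> real \<Rightarrow> real) \<Rightarrow> ereal" where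
  "free_energy \<beta> \<theta> W D \<rho> =
     ereal (inverse \<beta>) * extended_integral phase_measure (\<lambda>z. \<rho> z * ln (\<rho> z))
     + ereal (\<theta> / 2 * (\<integral>(v, y). (\<integral>(u, x). W x y * D (u - v) * \<rho> (u, x) * \<rho> (v, y)
                          \<partial>phase_measure) \<partial>phase_measure))"

text \<open>By convexity of \<open>r ln r\<close> the free energy is finite along the whole segment, so
  \<^const>\<open>real_of_ereal\<close> does not identify \<open>\<infinity>\<close> with \<open>0\<close> here.\<close>

definition critical_point ::
  "real \<Rightarrow> real \<Rightarrow> (real \<Rightarrow> real \<Rightarrow> real) \<Rightarrow> (real \<Rightarrow> real) \<Rightarrow> (real \<times> real \<Rightarrow> real) \<Rightarrow> bool" where
  "critical_point \<beta> \<theta> W D \<rho> \<longleftrightarrow>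
     P2L_density \<rho> \<and> free_energy \<beta> \<theta> W D \<rho> < \<infinity> \<and>
     (\<forall>\<rho>1. P2L_density \<rho>1 \<and> free_energy \<beta> \<theta> W D \<rho>1 < \<infinity> \<longrightarrow>
        ((\<lambda>s. real_of_ereal (free_energy \<beta> \<theta> W D (\<lambda>z. (1 - s) * \<rho> z + s * \<rho>1 z)))
           has_real_derivative 0) (at 0 within {0..1}))"

end

theory Submission
  imports Defs
begin

text \<open>
  Both properties of \<open>\<rho>\<close> are equivalent to the self-consistency equation
  \<open>\<rho>(u, x) = exp (- \<beta> \<theta> V(u, x)) / Z(x)\<close> almost everywhere, where
  \<open>V(u, x) = \<integral> W(x, y) D(u - v) \<rho>(v, y) d(v, y)\<close> is Lipschitz in \<open>u\<close> with almost everywhere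
  derivative the drift.

  For almost every \<open>x\<close> the weak equation says that \<open>\<integral> r (\<psi>' - a \<psi>) = 0\<close> for \<open>r = \<rho>(\<cdot>, x)\<close>,
  \<open>a = A'\<close>, \<open>A = \<beta> \<theta> V(\<cdot>, x)\<close> and every smooth periodic mean-free \<open>\<psi>\<close>. Uniform approximation and
  difference quotients extend this to Lipschitz \<open>\<psi>\<close>. The choice \<open>\<psi> = exp A \<cdot> \<xi>\<close> turns it into
  \<open>\<integral> r (exp A) \<xi>' = 0\<close>, where \<open>\<xi>'\<close> may be any bounded mean-free function, so
  \<open>r exp A\<close> is constant.

  For a Gibbs density \<open>ln \<rho>\<close> is bounded, and dominated convergence gives the directional
  derivative \<open>\<integral> (\<rho>\<^sub>1 - \<rho>) (\<beta>\<inverse> (1 + ln \<rho>) + \<theta> V)\<close>, which vanishes because the bracket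
  depends on \<open>x\<close> only. Conversely, at a critical point one moves towards the Gibbs density \<open>g\<close>
  built from \<open>\<rho>\<close>: convexity of \<open>r ln r\<close> bounds the relative entropy of \<open>\<rho>\<close> with respect to
  \<open>g\<close> by a multiple of minus the derivative, hence by zero, so \<open>\<rho> = g\<close>.
\<close>

subsection \<open>Lipschitz functions on the line\<close>

text \<open>Three obstacles shape the proof. The drift contains \<open>deriv D\<close> for a merely
  Lipschitz \<open>D\<close>, a total function with an arbitrary default value, so measurability,
  boundedness and the fundamental theorem are needed for \<open>deriv\<close> of Lipschitz
  functions. The function exp A times \<xi> is only Lipschitz, while the weak equation speaks of
  smooth tests. The equation is therefore extended twice: to C^2 functions, whose second derivative
  can be approximated uniformly, and then to Lipschitz functions, where only bounded pointwise
  convergence of the derivatives is available. Finally, r ln r has slope minus infinity at 0, and a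
  critical point might a priori vanish on a large set. Hence the entropy is differentiated only at
  Gibbs densities, which are bounded away from 0; at a critical point only the convex upper bound of
  the difference quotient enters. Symmetry of \<open>W\<close> and evenness of \<open>D\<close> make
  the interaction a symmetric bilinear form, which turns the factor \<theta>/2 into \<theta>. The
  factor Z(x) drops out because all competitors share one label marginal.\<close>

text \<open>Differentiability at a point is a Cauchy condition on difference quotients. By
  continuity rational increments suffice, so the points of differentiability form a Borel set. On it
  \<open>deriv f\<close> is a limit along one fixed sequence of increments, off it a
  constant.\<close>

lemma borel_measurable_deriv:
  fixes f :: "real \<Rightarrow> real"
  assumes cont: "continuous_on UNIV f"
  shows "deriv f \<in> borel_measurable borel"
proof -
  have half: "\<bar>a - d\<bar> < e / 2 \<Longrightarrow> \<bar>b - d\<bar> < e / 2 \<Longrightarrow> \<bar>a - b\<bar> \<le> e" for a b d e :: real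
    by linarith
  have fm[measurable]: "f \<in> borel_measurable borel"
    by (rule borel_measurable_continuous_onI[OF cont])
  define q where "q h x = (f (x + h) - f x) / h" for h x
  \<comment> \<open>The value of \<open>deriv f\<close> wherever no derivative exists: the choice is
    then made from an always false predicate.\<close>
  define c where "c = (SOME D::real. False)"
  define S where "S = {x. \<forall>n. \<exists>m. \<forall>r\<in>\<rat> \<inter> {r. r \<noteq> 0 \<and> \<bar>r\<bar> < 1 / real (Suc m)}.
      \<forall>s\<in>\<rat> \<inter> {r. r \<noteq> 0 \<and> \<bar>r\<bar> < 1 / real (Suc m)}. \<bar>q r x - q s x\<bar> \<le> 1 / real (Suc n)}"
  have [measurable]: "q h \<in> borel_measurable borel" for h
    unfolding q_def by measurable
  have cnt: "countable (\<rat> \<inter> {r. r \<noteq> 0 \<and> \<bar>r\<bar> < 1 / real (Suc m)})" for m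
    by (intro countable_Int1 countable_rat)
  have Sm: "S \<in> sets borel"
  proof -
    define Q where "Q m = \<rat> \<inter> {r. r \<noteq> 0 \<and> \<bar>r\<bar> < 1 / real (Suc m)}" for m
    have "S = (\<Inter>n. \<Union>m. \<Inter>r\<in>Q m. \<Inter>s\<in>Q m. {x \<in> space borel. \<bar>q r x - q s x\<bar> \<le> 1 / real (Suc n)})"
      by (simp only: S_def Q_def set_eq_iff mem_Collect_eq INT_iff UN_iff space_borel UNIV_I simp_thms ball_UNIV bex_UNIV)
    also have "\<dots> \<in> sets borel"
    proof -
      have *: "{x \<in> space borel. \<bar>q r x - q s x\<bar> \<le> 1 / real (Suc n)} \<in> sets borel" for r s n
        by measurable
      have **: "countable (Q m)" for m using cnt unfolding Q_def .
      show ?thesis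
        by (rule sets.countable_INT''[OF _ countableI_type], simp, rule sets.countable_UN''[OF countableI_type],
            rule sets.countable_INT''[OF _ **], simp, rule sets.countable_INT''[OF _ **], simp, rule *)
    qed
    finally show ?thesis .
  qed
  have diff_in_S: "x \<in> S" if "(f has_real_derivative d) (at x)" for x d
  proof -
    have lim: "((\<lambda>h. q h x) \<longlongrightarrow> d) (at 0)"
      using that unfolding q_def has_field_derivative_def has_derivative_at
      by (metis DERIV_def has_field_derivative_def that)
    show ?thesis unfolding S_def
    proof (intro CollectI allI)
      fix n
      have "\<forall>\<^sub>F h in at 0. dist (q h x) d < 1 / real (Suc n) / 2"
        using lim by (rule tendstoD) simp
      then obtain e where e: "e > 0" "\<And>h. h \<noteq> 0 \<Longrightarrow> \<bar>h\<bar> < e \<Longrightarrow> \<bar>q h x - d\<bar> < 1 / real (Suc n) / 2"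
        unfolding eventually_at by (auto simp: dist_real_def)
      obtain m where m: "1 / real (Suc m) < e"
        using e(1) nat_approx_posE by blast
      show "\<exists>m. \<forall>r\<in>\<rat> \<inter> {r. r \<noteq> 0 \<and> \<bar>r\<bar> < 1 / real (Suc m)}.
        \<forall>s\<in>\<rat> \<inter> {r. r \<noteq> 0 \<and> \<bar>r\<bar> < 1 / real (Suc m)}. \<bar>q r x - q s x\<bar> \<le> 1 / real (Suc n)"
      proof (intro exI[of _ m] ballI)
        fix r s assume "r \<in> \<rat> \<inter> {r. r \<noteq> 0 \<and> \<bar>r\<bar> < 1 / real (Suc m)}"
          "s \<in> \<rat> \<inter> {r. r \<noteq> 0 \<and> \<bar>r\<bar> < 1 / real (Suc m)}"
        then have "\<bar>q r x - d\<bar> < 1 / real (Suc n) / 2" "\<bar>q s x - d\<bar> < 1 / real (Suc n) / 2"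
          using e(2) m by (auto intro!: e(2))
        then show "\<bar>q r x - q s x\<bar> \<le> 1 / real (Suc n)" by (rule half)
      qed
    qed
  qed
  have S_lim: "\<exists>d. ((\<lambda>h. q h x) \<longlongrightarrow> d) (at 0)" if "x \<in> S" for x
  proof -
    \<comment> \<open>The condition passes from rational to real increments, since the quotient is
      continuous in a nonzero increment and the rationals are dense in the punctured
      interval.\<close>
    have le: "\<exists>e>0. \<forall>r s. r \<noteq> 0 \<and> s \<noteq> 0 \<and> \<bar>r\<bar> < e \<and> \<bar>s\<bar> < e \<longrightarrow> \<bar>q r x - q s x\<bar> \<le> 1 / real (Suc n)" for n
    proof -
      obtain m where m: "\<And>r s. r \<in> \<rat> \<Longrightarrow> s \<in> \<rat> \<Longrightarrow> r \<noteq> 0 \<Longrightarrow> s \<noteq> 0 \<Longrightarrow> \<bar>r\<bar> < 1 / real (Suc m) \<Longrightarrow>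
        \<bar>s\<bar> < 1 / real (Suc m) \<Longrightarrow> \<bar>q r x - q s x\<bar> \<le> 1 / real (Suc n)"
      proof -
        from \<open>x \<in> S\<close> have "\<exists>m. \<forall>r\<in>\<rat> \<inter> {r. r \<noteq> 0 \<and> \<bar>r\<bar> < 1 / real (Suc m)}.
          \<forall>s\<in>\<rat> \<inter> {r. r \<noteq> 0 \<and> \<bar>r\<bar> < 1 / real (Suc m)}. \<bar>q r x - q s x\<bar> \<le> 1 / real (Suc n)"
          unfolding S_def by blast
        then obtain m where m: "\<forall>r\<in>\<rat> \<inter> {r. r \<noteq> 0 \<and> \<bar>r\<bar> < 1 / real (Suc m)}.
          \<forall>s\<in>\<rat> \<inter> {r. r \<noteq> 0 \<and> \<bar>r\<bar> < 1 / real (Suc m)}. \<bar>q r x - q s x\<bar> \<le> 1 / real (Suc n)" ..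
        show ?thesis by (rule that[of m], rule m[rule_format]) blast+
      qed
      have app: "\<exists>R. (\<forall>k::nat. R k \<in> \<rat> \<and> R k \<noteq> 0 \<and> \<bar>R k\<bar> < 1 / real (Suc m)) \<and> R \<longlonglongrightarrow> r"
        if "r \<noteq> 0" "\<bar>r\<bar> < 1 / real (Suc m)" for r
      proof -
        let ?U = "{t. t \<noteq> 0 \<and> \<bar>t\<bar> < 1 / real (Suc m)}"
        have "open ?U"
          by (intro open_Collect_conj open_Collect_neq open_Collect_less continuous_intros)
        have "r \<in> closure (?U \<inter> \<rat>)"
          using open_Int_closure_subset[OF \<open>open ?U\<close>, of "\<rat>"] that
          by (auto simp: Rats_closure_real)
        then show ?thesis unfolding closure_sequential by auto
      qed
      have "\<bar>q r x - q s x\<bar> \<le> 1 / real (Suc n)"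
        if rs: "r \<noteq> 0" "s \<noteq> 0" "\<bar>r\<bar> < 1 / real (Suc m)" "\<bar>s\<bar> < 1 / real (Suc m)" for r s
      proof -
        obtain R T where R: "\<And>k::nat. R k \<in> \<rat> \<and> R k \<noteq> 0 \<and> \<bar>R k\<bar> < 1 / real (Suc m)" "R \<longlonglongrightarrow> r"
          and T: "\<And>k::nat. T k \<in> \<rat> \<and> T k \<noteq> 0 \<and> \<bar>T k\<bar> < 1 / real (Suc m)" "T \<longlonglongrightarrow> s"
          using app[of r] app[of s] rs by auto
        have "(\<lambda>k. q (R k) x) \<longlonglongrightarrow> q r x" "(\<lambda>k. q (T k) x) \<longlonglongrightarrow> q s x"
          unfolding q_def using rs
          by (auto intro!: tendsto_intros R T continuous_on_tendsto_compose[OF cont])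
        then have "(\<lambda>k. \<bar>q (R k) x - q (T k) x\<bar>) \<longlonglongrightarrow> \<bar>q r x - q s x\<bar>"
          by (intro tendsto_intros)
        then show ?thesis
          by (rule Lim_bounded[where M=0]) (use m R T in auto)
      qed
      then show ?thesis by (intro exI[of _ "1 / real (Suc m)"]) auto
    qed
    have "Cauchy (\<lambda>k. q (1 / real (Suc k)) x)"
    proof (rule metric_CauchyI)
      fix e::real assume "0 < e"
      then obtain n where n: "1 / real (Suc n) < e" using nat_approx_posE by blast
      obtain e' where e': "e' > 0" "\<And>r s. r \<noteq> 0 \<Longrightarrow> s \<noteq> 0 \<Longrightarrow> \<bar>r\<bar> < e' \<Longrightarrow> \<bar>s\<bar> < e' \<Longrightarrow> \<bar>q r x - q s x\<bar> \<le> 1 / real (Suc n)"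
        using le[of n] by auto
      obtain M where M: "1 / real (Suc M) < e'" using e'(1) nat_approx_posE by blast
      show "\<exists>M. \<forall>m\<ge>M. \<forall>n\<ge>M. dist (q (1 / real (Suc m)) x) (q (1 / real (Suc n)) x) < e"
      proof (intro exI[of _ M] allI impI)
        fix i j assume "M \<le> i" "M \<le> j"
        then have "1 / real (Suc i) < e'" "1 / real (Suc j) < e'"
          using M by (auto intro: le_less_trans[OF _ M] simp: frac_le)
        then have "\<bar>q (1 / real (Suc i)) x - q (1 / real (Suc j)) x\<bar> \<le> 1 / real (Suc n)"
          by (intro e') auto
        then show "dist (q (1 / real (Suc i)) x) (q (1 / real (Suc j)) x) < e"
          using n by (simp add: dist_real_def)
      qed
    qed
    then obtain d where d: "(\<lambda>k. q (1 / real (Suc k)) x) \<longlonglongrightarrow> d"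
      using Cauchy_convergent convergent_def by blast
    \<comment> \<open>The sequence only supplies the candidate \<open>d\<close>; letting k tend to
      infinity in \<open>le\<close> gives convergence over all increments.\<close>
    have "((\<lambda>h. q h x) \<longlongrightarrow> d) (at 0)"
    proof (rule tendstoI)
      fix e::real assume "0 < e"
      then obtain n where n: "1 / real (Suc n) < e" using nat_approx_posE by blast
      obtain e' where e': "e' > 0" "\<And>r s. r \<noteq> 0 \<Longrightarrow> s \<noteq> 0 \<Longrightarrow> \<bar>r\<bar> < e' \<Longrightarrow> \<bar>s\<bar> < e' \<Longrightarrow> \<bar>q r x - q s x\<bar> \<le> 1 / real (Suc n)"
        using le[of n] by auto
      obtain M where M: "1 / real (Suc M) < e'" using e'(1) nat_approx_posE by blast
      have "dist (q h x) d < e" if h: "h \<noteq> 0" "\<bar>h\<bar> < e'" for h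
      proof -
        have "(\<lambda>k. \<bar>q h x - q (1 / real (Suc k)) x\<bar>) \<longlonglongrightarrow> \<bar>q h x - d\<bar>"
          by (intro tendsto_intros d)
        then have "\<bar>q h x - d\<bar> \<le> 1 / real (Suc n)"
        proof (rule Lim_bounded[where M=M], intro allI impI)
          fix k assume "M \<le> k"
          then have "1 / real (Suc k) < e'"
            by (intro le_less_trans[OF _ M]) (simp add: frac_le)
          then show "\<bar>q h x - q (1 / real (Suc k)) x\<bar> \<le> 1 / real (Suc n)"
            using h by (intro e') auto
        qed
        then show ?thesis using n by (simp add: dist_real_def)
      qed
      then show "\<forall>\<^sub>F h in at 0. dist (q h x) d < e"
        unfolding eventually_at using e'(1) by (auto simp: dist_real_def)
    qed
    then show ?thesis by blast
  qed
  have eq: "deriv f x = (if x \<in> S then lim (\<lambda>k. q (1 / real (Suc k)) x) else c)" for x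
  proof (cases "x \<in> S")
    case True
    then obtain d where d: "((\<lambda>h. q h x) \<longlongrightarrow> d) (at 0)" using S_lim by blast
    have D: "(f has_real_derivative d) (at x)"
      using d unfolding q_def DERIV_def .
    have "filterlim (\<lambda>k. 1 / real (Suc k)) (at 0) sequentially"
      unfolding filterlim_at using LIMSEQ_Suc[OF lim_inverse_n'] by auto
    then have "(\<lambda>k. q (1 / real (Suc k)) x) \<longlonglongrightarrow> d"
      using filterlim_compose[OF d] by blast
    then show ?thesis using True by (simp add: limI DERIV_imp_deriv[OF D] del: of_nat_Suc)
  next
    case False
    then have "\<And>D. \<not> (f has_real_derivative D) (at x)" using diff_in_S by blast
    then show ?thesis using False unfolding deriv_def c_def by simp
  qed
  have "(\<lambda>x. if x \<in> S then lim (\<lambda>k. q (1 / real (Suc k)) x) else c) \<in> borel_measurable borel"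
    using Sm by (intro measurable_If_set borel_measurable_lim_metric) auto
  then show ?thesis using eq by presburger
qed

section \<open>Lebesgue differentiation on the line\<close>

text \<open>The differentiation theorem applied here controls averages over cubes with lower corner
  x, which in dimension one gives right derivatives only.\<close>

lemma lebesgue_differentiation_right:
  fixes g F :: "real \<Rightarrow> real"
  assumes int: "\<And>a b. g integrable_on {a..b}"
    and F: "\<And>a b. a \<le> b \<Longrightarrow> F b - F a = integral {a..b} g"
  shows "AE x in lborel. (F has_real_derivative g x) (at_right x)"
proof -
  have int': "g integrable_on cbox a b" for a b
    by (subst box_real(2)) (rule int)
  obtain N where N: "negligible N" and
    lim: "\<And>x e. \<lbrakk>x \<notin> N; 0 < e\<rbrakk> \<Longrightarrow>
               \<exists>d>0. \<forall>h. 0 < h \<and> h < d \<longrightarrow>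
                  norm(integral (cbox x (x + h *\<^sub>R One)) g /\<^sub>R h ^ DIM(real) - g x) < e"
    using integrable_ccontinuous_explicit[of g, OF int'] by blast
  have "(F has_real_derivative g x) (at_right x)" if "x \<notin> N" for x
    unfolding has_field_derivative_iff
  proof (rule tendstoI)
    fix e::real assume "0 < e"
    obtain d where d: "d > 0"
      "\<And>h. 0 < h \<Longrightarrow> h < d \<Longrightarrow> \<bar>integral {x..x + h} g / h - g x\<bar> < e"
    proof -
      have "norm (integral (cbox x (x + h *\<^sub>R One)) g /\<^sub>R h ^ DIM(real) - g x) = \<bar>integral {x..x + h} g / h - g x\<bar>" for h
        by (simp add: divide_inverse_commute)
      with lim[OF \<open>x \<notin> N\<close> \<open>0 < e\<close>]
      have "\<exists>d>0. \<forall>h. 0 < h \<and> h < d \<longrightarrow> \<bar>integral {x..x + h} g / h - g x\<bar> < e"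
        by simp
      then show ?thesis using that by blast
    qed
    have "dist ((F y - F x) / (y - x)) (g x) < e" if "y > x" "y < x + d" for y
      using d(2)[of "y - x"] F[of x y] that by (simp add: dist_real_def)
    then show "\<forall>\<^sub>F y in at_right x. dist ((F y - F x) / (y - x)) (g x) < e"
      unfolding eventually_at_right_field using d(1) by (intro exI[of _ "x + d"]) auto
  qed
  moreover have "AE x in lborel. x \<notin> N"
    using AE_not_in[of N "completion lborel"] N by (simp add: AE_completion_iff negligible_iff_null_sets)
  ultimately show ?thesis by (auto elim: eventually_mono)
qed

text \<open>The left derivative of F at x is the right derivative of y \<mapsto> - F(- y) at -x.
  Lebesgue measure is invariant under reflection, so the one-sided result serves for both
  sides.\<close>

lemma lebesgue_differentiation:
  fixes g F :: "real \<Rightarrow> real"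
  assumes int: "\<And>a b. g integrable_on {a..b}"
    and F: "\<And>a b. a \<le> b \<Longrightarrow> F b - F a = integral {a..b} g"
  shows "AE x in lborel. (F has_real_derivative g x) (at x)"
proof -
  have r: "AE x in lborel. (F has_real_derivative g x) (at_right x)"
    by (rule lebesgue_differentiation_right[OF assms])
  have "AE x in lborel. ((\<lambda>x. - F (- x)) has_real_derivative g (- x)) (at_right x)"
  proof (rule lebesgue_differentiation_right)
    show "(\<lambda>x. g (- x)) integrable_on {a..b}" for a b
      using int[of "-b" "-a"] Henstock_Kurzweil_Integration.integrable_reflect_real[where f = g and a = "-b" and b = "-a"] by simp
    show "- F (- b) - - F (- a) = integral {a..b} (\<lambda>x. g (- x))" if "a \<le> b" for a b
      using F[of "-b" "-a"] that Henstock_Kurzweil_Integration.integral_reflect_real[where f = g and a = "-b" and b = "-a"] by simp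
  qed
  then have "AE x in distr lborel borel uminus. ((\<lambda>x. - F (- x)) has_real_derivative g (- x)) (at_right x)"
    by (simp only: lborel_distr_uminus)
  then have l: "AE x in lborel. ((\<lambda>x. - F (- x)) has_real_derivative g x) (at_right (- x))"
    using AE_distrD[of uminus lborel borel "\<lambda>x. ((\<lambda>x. - F (- x)) has_real_derivative g (- x)) (at_right x)"]
    unfolding minus_minus by simp
  show ?thesis using r l
  proof eventually_elim
    case (elim x)
    have "((\<lambda>y. - F (- (- y))) has_real_derivative g x * (-1)) (at x within {..<x})"
      using elim(2)
      by (intro DERIV_image_chain[of "\<lambda>x. - F (- x)" _ uminus, unfolded o_def]) (auto intro!: derivative_eq_intros simp: image_uminus_lessThan)
    then have "(F has_real_derivative g x) (at_left x)"
      using DERIV_minus by fastforce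
    then show ?case
      using elim(1) by (simp add: has_field_derivative_def has_derivative_at_within filterlim_at_split has_field_derivative_iff)
  qed
qed


section \<open>Lipschitz functions as integrals of their derivatives\<close>

text \<open>A continuous \<open>F\<close> charges no point, so end points do not matter. Open
  intervals are the form in which boxes characterise \<open>lborel\<close>.\<close>

lemma emeasure_interval_measure_Ioo:
  assumes "a \<le> b" and mono: "\<And>x y. x \<le> y \<Longrightarrow> F x \<le> F y" and cont: "continuous_on UNIV F"
  shows "emeasure (interval_measure F) {a<..<b} = ennreal (F b - F a)"
proof -
  have sing: "{c} \<in> null_sets (interval_measure F)" for c
    using emeasure_interval_measure_Icc[OF order_refl[of c] mono cont] by (simp add: null_sets_def)
  have "{a<..<b} = {a..b} - ({a} \<union> {b})" by auto
  then have "emeasure (interval_measure F) {a<..<b} = emeasure (interval_measure F) {a..b}"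
    by (simp only:) (intro emeasure_Diff_null_set null_sets.Un sing; simp)
  then show ?thesis using emeasure_interval_measure_Icc[OF assms] by simp
qed

text \<open>The two Stieltjes measures add up to a measure giving every box its length, hence to
  Lebesgue measure. A null set of the sum is null for each summand.\<close>

lemma absolutely_continuous_interval_measure:
  fixes F G :: "real \<Rightarrow> real"
  assumes F: "\<And>x y. x \<le> y \<Longrightarrow> F x \<le> F y" "continuous_on UNIV F"
    and G: "\<And>x y. x \<le> y \<Longrightarrow> G x \<le> G y" "continuous_on UNIV G"
    and sum: "\<And>x. F x + G x = x"
  shows "absolutely_continuous lborel (interval_measure F)"
proof -
  define M where "M = measure_of UNIV (sets borel)
      (\<lambda>A. emeasure (interval_measure F) A + emeasure (interval_measure G) A)"
  have em: "emeasure M A = emeasure (interval_measure F) A + emeasure (interval_measure G) A"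
    if "A \<in> sets borel" for A
    unfolding M_def
  proof (rule emeasure_measure_of_sigma)
    show "sigma_algebra UNIV (sets borel)"
      using sets.sigma_algebra_axioms[of borel] by simp
    show "countably_additive (sets borel) (\<lambda>A. emeasure (interval_measure F) A + emeasure (interval_measure G) A)"
      unfolding countably_additive_def
      by (auto simp: suminf_add[symmetric] suminf_emeasure)
  qed (auto simp: positive_def that)
  have "lborel = M"
  proof (rule lborel_eqI)
    fix l u :: real assume "\<And>b. b \<in> Basis \<Longrightarrow> l \<bullet> b \<le> u \<bullet> b"
    then have "l \<le> u" by simp
    then have "emeasure M (box l u) = ennreal (F u - F l) + ennreal (G u - G l)"
      by (simp add: em emeasure_interval_measure_Ioo F G)
    also have "\<dots> = ennreal (u - l)"
      using F(1)[OF \<open>l \<le> u\<close>] G(1)[OF \<open>l \<le> u\<close>] sum[of u] sum[of l]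
      by (simp add: ennreal_plus[symmetric] del: ennreal_plus)
    finally show "emeasure M (box l u) = ennreal (\<Prod>b\<in>Basis. (u - l) \<bullet> b)" by simp
  qed (use sets.sigma_sets_eq[of borel] in \<open>simp add: M_def\<close>)
  then show ?thesis
    unfolding absolutely_continuous_def null_sets_def
    using em by (auto simp: add_eq_0_iff_both_eq_0)
qed

text \<open>Adding a multiple of the identity makes a Lipschitz function monotone. Its Stieltjes
  measure then has a Radon-Nikodym density.\<close>

lemma lipschitz_density:
  fixes f :: "real \<Rightarrow> real"
  assumes lip: "L-lipschitz_on UNIV f"
  obtains g where "g \<in> borel_measurable borel" "\<And>a b. set_integrable lborel {a..b} g"
    "\<And>a b. a \<le> b \<Longrightarrow> f b - f a = (LINT x:{a..b}|lborel. g x)"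
proof -
  \<comment> \<open>One more than \<open>L\<close>, so that dividing by \<open>2 * K\<close> is
    legitimate when \<open>L\<close> is 0.\<close>
  define K where "K = L + 1"
  have L: "0 \<le> L" using lipschitz_on_nonneg[OF lip] .
  then have K: "K > 0" by (simp add: K_def)
  have cont: "continuous_on UNIV f" by (rule lipschitz_on_continuous_on[OF lip])
  have bnd: "\<bar>f y - f x\<bar> \<le> K * (y - x)" if "x \<le> y" for x y
    using lipschitz_onD[OF lip, of y x] that by (simp add: dist_real_def K_def algebra_simps)
  \<comment> \<open>\<open>F\<close> and \<open>G\<close> are nondecreasing by \<open>bnd\<close>
    and scaled to add up to the identity, as the comparison with Lebesgue measure requires.\<close>
  define F where "F x = (K * x + f x) / (2 * K)" for x
  define G where "G x = (K * x - f x) / (2 * K)" for x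
  have F: "F x \<le> F y" and G: "G x \<le> G y" if "x \<le> y" for x y
    using bnd[OF that] K unfolding F_def G_def by (auto intro!: divide_right_mono simp: algebra_simps)
  have Fc: "continuous_on UNIV F" and Gc: "continuous_on UNIV G"
    unfolding F_def G_def using K by (auto intro!: continuous_intros cont)
  have sum: "F x + G x = x" for x
    using K by (simp add: F_def G_def add_divide_distrib[symmetric])
  let ?N = "interval_measure F"
  have ac: "absolutely_continuous lborel ?N"
    by (rule absolutely_continuous_interval_measure[OF F Fc G Gc sum])
  have sf: "sigma_finite_measure ?N"
    using Fc by (intro sigma_finite_interval_measure F)
      (auto intro: continuous_within_subset simp: continuous_on_eq_continuous_within)
  define h where "h x = enn2real (RN_deriv lborel ?N x)" for x
  have hm[measurable]: "h \<in> borel_measurable borel"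
    unfolding h_def using borel_measurable_RN_deriv[of lborel ?N] by simp
  have fin: "AE x in lborel. RN_deriv lborel ?N x = ennreal (h x)"
    using sigma_finite_measure.RN_deriv_finite[OF lborel.sigma_finite_measure_axioms sf ac] by (auto simp: h_def less_top elim!: eventually_mono)
  have hb: "has_bochner_integral lborel (\<lambda>x. indicator {a..b} x *\<^sub>R h x) (F b - F a)" if "a \<le> b" for a b
  proof (rule has_bochner_integral_nn_integral)
    have "ennreal (F b - F a) = emeasure (density lborel (RN_deriv lborel ?N)) {a..b}"
      using emeasure_interval_measure_Icc[OF that F Fc] sigma_finite_measure.density_RN_deriv[OF lborel.sigma_finite_measure_axioms ac] by simp
    also have "\<dots> = (\<integral>\<^sup>+x. RN_deriv lborel ?N x * indicator {a..b} x \<partial>lborel)"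
      by (rule emeasure_density) auto
    also have "\<dots> = (\<integral>\<^sup>+x. ennreal (indicator {a..b} x *\<^sub>R h x) \<partial>lborel)"
      by (rule nn_integral_cong_AE) (use fin in \<open>auto simp: indicator_def elim!: eventually_mono\<close>)
    finally show "(\<integral>\<^sup>+x. ennreal (indicator {a..b} x *\<^sub>R h x) \<partial>lborel) = ennreal (F b - F a)" ..
  qed (use F[OF that] in \<open>auto simp: h_def\<close>)
  have hi: "set_integrable lborel {a..b} h" for a b
    using hb[of a b] by (cases "a \<le> b") (auto simp: set_integrable_def has_bochner_integral_iff)
  \<comment> \<open>Solving the definition of \<open>F\<close> gives f x = 2 K F x - K x, so this
    combination is a density of \<open>f\<close> when \<open>h\<close> is one of
    \<open>F\<close>.\<close>
  define g where "g x = 2 * K * h x - K" for x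
  have Ki: "set_integrable lborel {a..b} (\<lambda>_. K)" for a b :: real
    unfolding set_integrable_def by (intro integrable_scaleR_left) (simp add: integrable_indicator_iff emeasure_lborel_Icc_eq)
  have gi: "set_integrable lborel {a..b} g" for a b
    unfolding g_def by (intro set_integral_diff set_integrable_mult_right hi Ki)
  moreover have "f b - f a = (LINT x:{a..b}|lborel. g x)" if "a \<le> b" for a b
  proof -
    have "(LINT x:{a..b}|lborel. g x) = 2 * K * (LINT x:{a..b}|lborel. h x) - (LINT x:{a..b}|lborel. K)"
      unfolding g_def
      by (subst set_integral_diff(2)) (auto intro!: set_integrable_mult_right hi Ki)
    also have "(LINT x:{a..b}|lborel. h x) = F b - F a"
      using hb[OF that] by (simp add: set_lebesgue_integral_def has_bochner_integral_iff)
    also have "(LINT x:{a..b}|lborel. K) = K * (b - a)"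
      using that by (simp add: set_lebesgue_integral_def)
    also have "2 * K * (F b - F a) = K * b + f b - (K * a + f a)"
      using K by (simp add: F_def diff_divide_distrib[symmetric])
    finally show ?thesis by (simp add: algebra_simps)
  qed
  moreover have "g \<in> borel_measurable borel" unfolding g_def by measurable
  ultimately show ?thesis using that by blast
qed

text \<open>Lebesgue differentiation identifies \<open>deriv f\<close> almost everywhere with the
  Radon-Nikodym density, and the integral formula carries over from the density.\<close>

lemma lipschitz_AE_has_deriv:
  fixes f :: "real \<Rightarrow> real"
  assumes lip: "L-lipschitz_on UNIV f"
  shows "AE x in lborel. (f has_real_derivative deriv f x) (at x)"
    and "a \<le> b \<Longrightarrow> (LINT x:{a..b}|lborel. deriv f x) = f b - f a"
proof -
  obtain g where g: "g \<in> borel_measurable borel" "\<And>a b. set_integrable lborel {a..b} g"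
    "\<And>a b. a \<le> b \<Longrightarrow> f b - f a = (LINT x:{a..b}|lborel. g x)"
    using lipschitz_density[OF lip] by blast
  have AE: "AE x in lborel. (f has_real_derivative g x) (at x)"
  proof (rule lebesgue_differentiation)
    show "g integrable_on {a..b}" for a b using set_borel_integral_eq_integral(1)[OF g(2)] .
    show "f b - f a = integral {a..b} g" if "a \<le> b" for a b
      using g(3)[OF that] set_borel_integral_eq_integral(2)[OF g(2)] by simp
  qed
  then show "AE x in lborel. (f has_real_derivative deriv f x) (at x)"
    by (auto simp: DERIV_imp_deriv elim!: eventually_mono)
  have m: "deriv f \<in> borel_measurable borel"
    by (rule borel_measurable_deriv[OF lipschitz_on_continuous_on[OF lip]])
  have "(LINT x:{a..b}|lborel. deriv f x) = (LINT x:{a..b}|lborel. g x)"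
    by (rule set_lebesgue_integral_cong_AE) (use m g(1) AE in \<open>auto simp: DERIV_imp_deriv elim!: eventually_mono\<close>)
  then show "(LINT x:{a..b}|lborel. deriv f x) = f b - f a" if "a \<le> b"
    using g(3)[OF that] by simp
qed

lemma lipschitz_deriv_le:
  fixes f :: "real \<Rightarrow> real"
  assumes lip: "L-lipschitz_on UNIV f" and d: "(f has_real_derivative d) (at x)"
  shows "\<bar>d\<bar> \<le> L"
proof (rule tendsto_upperbound)
  show "((\<lambda>y. \<bar>(f y - f x) / (y - x)\<bar>) \<longlongrightarrow> \<bar>d\<bar>) (at x)"
    using d unfolding has_field_derivative_iff by (rule tendsto_rabs)
  show "\<forall>\<^sub>F y in at x. \<bar>(f y - f x) / (y - x)\<bar> \<le> L"
    unfolding eventually_at using lipschitz_onD[OF lip, of _ x]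
    by (intro exI[of _ 1]) (auto simp: dist_real_def abs_divide divide_le_eq)
qed simp

text \<open>The bound has to cover the points without a derivative too, where \<open>deriv\<close>
  is the default value; hence a maximum of two constants.\<close>

lemma lipschitz_deriv_bounded:
  fixes f :: "real \<Rightarrow> real"
  assumes lip: "L-lipschitz_on UNIV f"
  obtains B where "\<And>x. \<bar>deriv f x\<bar> \<le> B"
proof -
  have "\<bar>deriv f x\<bar> \<le> max L \<bar>SOME D::real. False\<bar>" for x
  proof (cases "\<exists>d. (f has_real_derivative d) (at x)")
    case True
    then show ?thesis using lipschitz_deriv_le[OF lip] DERIV_imp_deriv by (metis max.coboundedI1)
  next
    case False
    then show ?thesis by (simp add: deriv_def)
  qed
  then show ?thesis using that by blast
qed

subsection \<open>Smooth periodic functions\<close>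

lemma periodic_of_int:
  fixes f :: "real \<Rightarrow> 'a"
  assumes per: "\<And>x. f (x + 2 * pi) = f x"
  shows "f (x + 2 * pi * of_int k) = f x"
proof -
  have nat: "f (x + 2 * pi * of_nat n) = f x" for x and n :: nat
  proof (induction n)
    case (Suc n)
    then show ?case using per[of "x + 2 * pi * of_nat n"] by (simp add: algebra_simps)
  qed simp
  show ?thesis
  proof (cases "k \<ge> 0")
    case True
    then show ?thesis using nat[of x "nat k"] by simp
  next
    case False
    then show ?thesis using nat[of "x + 2 * pi * of_int k" "nat (- k)"] by (simp add: algebra_simps)
  qed
qed

text \<open>The representative modulo 2 pi in the half-open interval; in particular 2 pi goes to 0.
  It serves to periodise indicators of subsets of [0, 2 pi].\<close>

definition reduce :: "real \<Rightarrow> real" where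
  "reduce x = x - 2 * pi * of_int \<lfloor>x / (2 * pi)\<rfloor>"

lemma reduce_range: "0 \<le> reduce x" "reduce x < 2 * pi"
proof -
  define n :: real where "n = of_int \<lfloor>x / (2 * pi)\<rfloor>"
  have "n \<le> x / (2 * pi)" "x / (2 * pi) < n + 1"
    unfolding n_def by linarith+
  then have "n * (2 * pi) \<le> x" "x < (n + 1) * (2 * pi)"
    by (simp_all only: pos_le_divide_eq pos_divide_less_eq pi_gt_zero zero_less_mult_iff zero_less_numeral simp_thms)
  then show "0 \<le> reduce x" "reduce x < 2 * pi"
    unfolding reduce_def n_def[symmetric] by (simp_all add: algebra_simps)
qed

lemma reduce_periodic: "reduce (x + 2 * pi) = reduce x"
  unfolding reduce_def by (simp add: add_divide_distrib algebra_simps)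

lemma reduce_eq: "0 \<le> x \<Longrightarrow> x < 2 * pi \<Longrightarrow> reduce x = x"
  unfolding reduce_def by (simp add: floor_eq_iff)

lemma periodic_reduce:
  fixes f :: "real \<Rightarrow> 'a"
  assumes per: "\<And>x. f (x + 2 * pi) = f x"
  shows "f (reduce x) = f x"
  using periodic_of_int[of f x "- \<lfloor>x / (2 * pi)\<rfloor>", OF per] by (simp add: reduce_def)

lemma periodic_bounded:
  fixes f :: "real \<Rightarrow> real"
  assumes cont: "continuous_on UNIV f" and per: "\<And>x. f (x + 2 * pi) = f x"
  obtains B where "B > 0" "\<And>x. \<bar>f x\<bar> \<le> B"
proof -
  have "compact (f ` {0..2 * pi})"
    by (intro compact_continuous_image continuous_on_subset[OF cont]) auto
  then obtain B where B: "B > 0" "\<forall>y\<in>f ` {0..2 * pi}. norm y \<le> B"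
    using compact_imp_bounded bounded_pos by metis
  have "\<bar>f x\<bar> \<le> B" for x
  proof -
    have "f (reduce x) \<in> f ` {0..2 * pi}" using reduce_range[of x] by auto
    then have "norm (f (reduce x)) \<le> B" using B(2) by blast
    then show ?thesis by (simp add: periodic_reduce[of f x, OF per])
  qed
  then show ?thesis using that B(1) by blast
qed

lemma lipschitz_mult:
  fixes f g :: "real \<Rightarrow> real"
  assumes f: "L-lipschitz_on UNIV f" "\<And>x. \<bar>f x\<bar> \<le> B" and g: "M-lipschitz_on UNIV g" "\<And>x. \<bar>g x\<bar> \<le> C"
  shows "(B * M + C * L)-lipschitz_on UNIV (\<lambda>x. f x * g x)"
proof (rule lipschitz_onI)
  have nn: "0 \<le> L" "0 \<le> M" "0 \<le> B" "0 \<le> C"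
    using lipschitz_on_nonneg[OF f(1)] lipschitz_on_nonneg[OF g(1)] f(2)[of 0] g(2)[of 0] by linarith+
  then show "0 \<le> B * M + C * L" by simp
  fix x y :: real
  have "f x * g x - f y * g y = f x * (g x - g y) + g y * (f x - f y)" by (simp add: algebra_simps)
  then have "\<bar>f x * g x - f y * g y\<bar> \<le> \<bar>f x\<bar> * \<bar>g x - g y\<bar> + \<bar>g y\<bar> * \<bar>f x - f y\<bar>"
    by (metis abs_mult abs_triangle_ineq)
  also have "\<dots> \<le> B * (M * \<bar>x - y\<bar>) + C * (L * \<bar>x - y\<bar>)"
    using lipschitz_onD[OF f(1), of x y] lipschitz_onD[OF g(1), of x y] f(2) g(2) nn
    by (intro add_mono mult_mono) (auto simp: dist_real_def)
  finally show "dist (f x * g x) (f y * g y) \<le> (B * M + C * L) * dist x y"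
    by (simp add: dist_real_def algebra_simps)
qed

lemma lipschitz_if_deriv_bounded:
  fixes f :: "real \<Rightarrow> real"
  assumes "\<And>x. (f has_real_derivative f' x) (at x)" and "\<And>x. \<bar>f' x\<bar> \<le> B"
  shows "B-lipschitz_on UNIV f"
proof (rule lipschitz_onI)
  show "0 \<le> B" using assms(2)[of 0] by linarith
  show "dist (f x) (f y) \<le> B * dist x y" for x y
    using field_differentiable_bound[of UNIV f f' B x y] assms by (simp add: dist_real_def)
qed

lemma lipschitz_exp:
  fixes f :: "real \<Rightarrow> real"
  assumes f: "L-lipschitz_on UNIV f" "\<And>x. \<bar>f x\<bar> \<le> B"
  shows "(exp B * L)-lipschitz_on UNIV (\<lambda>x. exp (f x))"
proof (rule lipschitz_onI)
  have L: "0 \<le> L" using lipschitz_on_nonneg[OF f(1)] .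
  then show "0 \<le> exp B * L" by simp
  fix x y :: real
  have "norm (exp (f x) - exp (f y)) \<le> exp B * norm (f x - f y)"
  proof (rule field_differentiable_bound[of "{- B..B}" exp exp])
    show "f x \<in> {- B..B}" "f y \<in> {- B..B}" using f(2)[of x] f(2)[of y] by (auto simp: abs_le_iff)
    show "(exp has_real_derivative exp z) (at z within {- B..B})" for z
      by (auto intro!: derivative_eq_intros)
  qed auto
  also have "\<dots> \<le> exp B * (L * dist x y)"
    using lipschitz_onD[OF f(1), of x y] by (simp add: dist_real_def)
  finally show "dist (exp (f x)) (exp (f y)) \<le> exp B * L * dist x y" by (simp add: dist_real_def)
qed

section \<open>Antiderivatives and smoothness classes\<close>

lemma primitive_exists:
  fixes h :: "real \<Rightarrow> real"
  assumes int: "\<And>a b. h integrable_on {a..b}"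
  obtains H where "\<And>a b. a \<le> b \<Longrightarrow> H b - H a = integral {a..b} h"
proof -
  \<comment> \<open>For nonzero x one of the two intervals is empty and contributes 0, so this is
    the signed integral from 0 to x.\<close>
  define H where "H x = integral {0..x} h - integral {x..0} h" for x
  have triv: "integral {x..y} h = 0" if "y \<le> x" for x y
    using that by (cases "x = y") auto
  have "H b - H a = integral {a..b} h" if ab: "a \<le> b" for a b
  proof -
    consider "0 \<le> a" | "a \<le> 0" "0 \<le> b" | "b \<le> 0" using ab by linarith
    then show ?thesis
    proof cases
      case 1
      then show ?thesis using Henstock_Kurzweil_Integration.integral_combine[OF 1 ab int] ab
        by (simp add: H_def triv)
    next
      case 2
      then show ?thesis using Henstock_Kurzweil_Integration.integral_combine[OF 2 int]
        by (simp add: H_def triv)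
    next
      case 3
      then show ?thesis using Henstock_Kurzweil_Integration.integral_combine[OF ab 3 int] ab
        by (simp add: H_def triv)
    qed
  qed
  then show ?thesis using that by blast
qed

lemma continuous_antiderivative_exists:
  fixes h :: "real \<Rightarrow> real"
  assumes cont: "continuous_on UNIV h"
  obtains H where "\<And>x. (H has_real_derivative h x) (at x)"
proof -
  have int: "h integrable_on {a..b}" for a b
    by (rule integrable_continuous_real) (rule continuous_on_subset[OF cont], simp)
  then obtain H where H: "\<And>a b. a \<le> b \<Longrightarrow> H b - H a = integral {a..b} h"
    using primitive_exists by blast
  have "(H has_real_derivative h x) (at x)" for x
  proof -
    have 1: "((\<lambda>y. H (x - 1) + integral {x - 1..y} h) has_real_derivative 0 + h x) (at x within {x - 1..x + 1})"
      by (intro DERIV_add DERIV_const integral_has_real_derivative continuous_on_subset[OF cont]) auto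
    have 2: "H (x - 1) + integral {x - 1..y} h = H y" if "y \<in> {x - 1..x + 1}" for y
      using H[of "x - 1" y] that by simp
    have "(H has_real_derivative 0 + h x) (at x within {x - 1..x + 1})"
      by (rule has_field_derivative_transform_within[OF 1 zero_less_one]) (use 2 in auto)
    then show ?thesis by (simp add: at_within_Icc_at)
  qed
  then show ?thesis using that by blast
qed

lemma deriv_periodic:
  fixes f :: "real \<Rightarrow> real"
  assumes "\<And>x. (f has_real_derivative f' x) (at x)" and per: "\<And>x. f (x + p) = f x"
  shows "f' (x + p) = f' x"
proof -
  have "((\<lambda>x. f (x + p)) has_real_derivative f' (x + p)) (at x)"
    using assms(1)[of "x + p"] by (simp add: DERIV_shift)
  then have "(f has_real_derivative f' (x + p)) (at x)"
    using per by simp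
  then show ?thesis using assms(1)[of x] DERIV_unique by blast
qed

lemma antiderivative_periodic:
  fixes f :: "real \<Rightarrow> real"
  assumes d: "\<And>x. (f has_real_derivative f' x) (at x)" and per: "\<And>x. f' (x + p) = f' x"
  shows "f (x + p) - f x = f p - f 0"
proof -
  have "((\<lambda>x. f (x + p) - f x) has_real_derivative 0) (at x)" for x
    using DERIV_diff[OF d[of "x + p", THEN DERIV_shift[THEN iffD1]] d[of x]] per by simp
  then show ?thesis using DERIV_isconst_all[of "\<lambda>x. f (x + p) - f x" x 0] by simp
qed

text \<open>The iterated derivatives in the definition of a test function are recast as a recursion
  on the order, for which closure under products is a plain induction.\<close>

primrec times_differentiable :: "nat \<Rightarrow> (real \<Rightarrow> real) \<Rightarrow> bool" where
  "times_differentiable 0 f = True"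
| "times_differentiable (Suc n) f \<longleftrightarrow> (\<forall>x. f differentiable at x) \<and> times_differentiable n (deriv f)"

lemma times_differentiable_iff:
  "times_differentiable n f \<longleftrightarrow> (\<forall>k<n. (deriv ^^ k) f differentiable_on UNIV)"
proof (induction n arbitrary: f)
  case (Suc n)
  have "(\<forall>k<Suc n. (deriv ^^ k) f differentiable_on UNIV) \<longleftrightarrow>
      f differentiable_on UNIV \<and> (\<forall>k<n. (deriv ^^ k) (deriv f) differentiable_on UNIV)"
    by (auto simp: All_less_Suc2 funpow_Suc_right simp del: funpow.simps) 
  then show ?case using Suc by (simp add: differentiable_on_def)
qed simp

lemma has_deriv: "f differentiable at x \<Longrightarrow> (f has_real_derivative deriv f x) (at x)"
  for f :: "real \<Rightarrow> real"
  using DERIV_imp_deriv real_differentiableE by metis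

lemma times_differentiable_antimono: "times_differentiable (Suc n) f \<Longrightarrow> times_differentiable n f"
  unfolding times_differentiable_iff by simp

lemma times_differentiable_const: "times_differentiable n (\<lambda>x. c)"
  by (induction n arbitrary: c) auto

lemma times_differentiable_add:
  "times_differentiable n f \<Longrightarrow> times_differentiable n g \<Longrightarrow> times_differentiable n (\<lambda>x. f x + g x)"
proof (induction n arbitrary: f g)
  case (Suc n)
  have "deriv (\<lambda>x. f x + g x) = (\<lambda>x. deriv f x + deriv g x)"
    using Suc.prems by (intro ext DERIV_imp_deriv DERIV_add has_deriv) auto
  then show ?case using Suc by auto
qed simp

lemma times_differentiable_mult:
  "times_differentiable n f \<Longrightarrow> times_differentiable n g \<Longrightarrow> times_differentiable n (\<lambda>x. f x * g x)"
proof (induction n arbitrary: f g)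
  case (Suc n)
  have "deriv (\<lambda>x. f x * g x) = (\<lambda>x. deriv f x * g x + deriv g x * f x)"
    using Suc.prems by (intro ext DERIV_imp_deriv DERIV_mult has_deriv) auto
  \<comment> \<open>The product rule pairs each derivative, of order \<open>n\<close>, with an
    undifferentiated factor, whose order must therefore be lowered to \<open>n\<close> as
    well.\<close>
  moreover have "times_differentiable n f" "times_differentiable n g"
    using Suc.prems times_differentiable_antimono by blast+
  ultimately show ?case using Suc times_differentiable_add by auto
qed simp

lemma times_differentiable_antiderivative:
  assumes "\<And>x. (F has_real_derivative f x) (at x)" and "times_differentiable n f"
  shows "times_differentiable (Suc n) F"
proof -
  have "deriv F = f" using assms(1) by (intro ext DERIV_imp_deriv)
  then show ?thesis using assms real_differentiable_def by auto
qed

text \<open>The induction treats both at once because each derivative is, up to sign, the other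
  function.\<close>

lemma times_differentiable_sin_cos: "times_differentiable n sin \<and> times_differentiable n cos"
proof (induction n)
  case (Suc n)
  have "times_differentiable n (\<lambda>x. - 1 * sin x)"
    using Suc by (intro times_differentiable_mult times_differentiable_const) auto
  moreover have "deriv sin = (cos :: real \<Rightarrow> real)" "deriv cos = (\<lambda>x::real. - 1 * sin x)"
    by (auto intro!: ext DERIV_imp_deriv derivative_eq_intros)
  ultimately show ?case
    using Suc by (auto simp: real_differentiable_def intro: DERIV_sin DERIV_cos)
qed simp

lemma periodic_test_functionI:
  assumes "\<And>n. times_differentiable n f" and "\<And>x. f (x + 2 * pi) = f x"
  shows "periodic_test_function f"
  using assms unfolding periodic_test_function_def times_differentiable_iff by (metis lessI)

lemma periodic_test_functionD:
  assumes "periodic_test_function f"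
  shows "(f has_real_derivative deriv f x) (at x)"
    and "(deriv f has_real_derivative deriv (deriv f) x) (at x)"
    and "continuous_on UNIV (deriv f)" and "continuous_on UNIV (deriv (deriv f))"
    and "f (x + 2 * pi) = f x"
    and "deriv f (x + 2 * pi) = deriv f x" and "deriv (deriv f) (x + 2 * pi) = deriv (deriv f) x"
proof -
  have *: "(deriv ^^ k) f differentiable_on UNIV" for k
    using assms unfolding periodic_test_function_def by blast
  show per: "f (x + 2 * pi) = f x" for x
    using assms unfolding periodic_test_function_def by blast
  show 1: "(f has_real_derivative deriv f x) (at x)" for x
    using *[of 0] by (intro has_deriv) (simp add: differentiable_on_def)
  show 2: "(deriv f has_real_derivative deriv (deriv f) x) (at x)" for x
    using *[of 1] by (intro has_deriv) (simp add: differentiable_on_def)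
  show "continuous_on UNIV (deriv f)"
    using *[of 1] differentiable_imp_continuous_on by simp
  show "continuous_on UNIV (deriv (deriv f))"
    using *[of 2] differentiable_imp_continuous_on by (simp add: numeral_2_eq_2)
  show 3: "deriv f (x + 2 * pi) = deriv f x" for x
    by (rule deriv_periodic[OF 1 per])
  show "deriv (deriv f) (x + 2 * pi) = deriv (deriv f) x"
    by (rule deriv_periodic[OF 2 3])
qed

section \<open>Approximation by trigonometric polynomials\<close>

text \<open>Two branches of the argument cover the circle: \<open>Arg\<close> is continuous off the
  negative axis, \<open>Arg2pi\<close> off the positive one. By periodicity \<open>q\<close> does
  not see the difference between them.\<close>

lemma continuous_on_circle_lift:
  fixes q :: "real \<Rightarrow> real"
  assumes cont: "continuous_on UNIV q" and per: "\<And>x. q (x + 2 * pi) = q x"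
  obtains f where "continuous_on (sphere 0 1) f" "\<And>t. f (cis t) = q t"
proof -
  have q_eq: "q s = q t" if "cis s = cis t" for s t
  proof -
    obtain n :: int where "s = t + 2 * pi * n"
      using \<open>cis s = cis t\<close> sin_cos_eq_iff[of s t] by (auto simp: complex_eq_iff)
    then show ?thesis using periodic_of_int[of q, OF per] by simp
  qed
  have a1: "cis (Arg z) = z" and a2: "cis (Arg2pi z) = z" if "norm z = 1" for z
    using that complex_norm_eq_1_exp[of z] complex_norm_eq_1_exp_eq[of z] by (auto simp: cis_conv_exp)
  let ?f = "\<lambda>z. q (Arg z)"
  have "continuous (at z within sphere 0 1) ?f" if z: "z \<in> sphere 0 1" for z
  proof (cases "z \<in> \<real>\<^sub>\<le>\<^sub>0")
    case False
    then have "isCont Arg z" by (rule continuous_at_Arg)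
    then have "isCont ?f z"
      using cont by (intro isCont_o2[of _ Arg q]) (auto simp: continuous_on_eq_continuous_at)
    then show ?thesis by (rule continuous_at_imp_continuous_at_within)
  next
    case True
    then have "z \<notin> \<real>\<^sub>\<ge>\<^sub>0" using z by (auto simp: complex_nonpos_Reals_iff complex_nonneg_Reals_iff complex_eq_iff norm_complex_def)
    then have "isCont Arg2pi z" by (rule continuous_at_Arg2pi)
    then have "isCont (\<lambda>z. q (Arg2pi z)) z"
      using cont by (intro isCont_o2[of _ Arg2pi q]) (auto simp: continuous_on_eq_continuous_at)
    then have "continuous (at z within sphere 0 1) (\<lambda>z. q (Arg2pi z))"
      by (rule continuous_at_imp_continuous_at_within)
    then show ?thesis
      by (rule continuous_transform_within[OF _ zero_less_one]) (use z in \<open>auto intro!: q_eq simp: a1 a2\<close>)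
  qed
  then have "continuous_on (sphere 0 1) ?f" by (simp add: continuous_on_eq_continuous_within)
  moreover have "?f (cis t) = q t" for t by (rule q_eq) (simp add: a1)
  ultimately show ?thesis using that by blast
qed

text \<open>Stone-Weierstrass on the unit circle: a real polynomial in the two coordinates, composed
  with \<open>cis\<close>, is a trigonometric polynomial, hence smooth and periodic.\<close>

lemma smooth_periodic_approximation:
  fixes q :: "real \<Rightarrow> real"
  assumes cont: "continuous_on UNIV q" and per: "\<And>x. q (x + 2 * pi) = q x" and e: "e > 0"
  obtains p where "\<And>n. times_differentiable n p" "\<And>x. p (x + 2 * pi) = p x" "\<And>x. \<bar>p x - q x\<bar> \<le> e"
proof -
  obtain f where f: "continuous_on (sphere 0 1) f" "\<And>t. f (cis t) = q t"
    using continuous_on_circle_lift[OF cont per] by blast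
  obtain g where g: "real_polynomial_function g" "\<And>z. z \<in> sphere 0 1 \<Longrightarrow> \<bar>f z - g z\<bar> < e"
    using Stone_Weierstrass_real_polynomial_function[OF compact_sphere f(1) e] by blast
  have "times_differentiable n (\<lambda>t. g (cis t))" for n
    using g(1)
  proof induction
    case (linear h)
    then interpret bounded_linear h .
    have "h (cis t) = cos t * h 1 + sin t * h \<i>" for t
    proof -
      have "cis t = cos t *\<^sub>R 1 + sin t *\<^sub>R \<i>" by (simp add: complex_eq_iff)
      then show ?thesis by (simp only: add scaleR) simp
    qed
    then show ?case
      using times_differentiable_sin_cos
      by (simp only:) (intro times_differentiable_add times_differentiable_mult times_differentiable_const; blast)
  qed (auto intro: times_differentiable_add times_differentiable_mult times_differentiable_const)
  moreover have "g (cis (x + 2 * pi)) = g (cis x)" for x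
    by (rule arg_cong[of _ _ g]) (simp add: complex_eq_iff)
  moreover have "\<bar>g (cis x) - q x\<bar> \<le> e" for x
    using g(2)[of "cis x"] f(2)[of x] by (simp add: abs_minus_commute less_imp_le)
  ultimately show ?thesis using that by blast
qed

subsection \<open>The weak equation on the circle\<close>

text \<open>As \<open>H\<close> is periodic, \<open>h\<close> has mean 0, so the mean
  \<open>m\<close> of \<open>p\<close> is at most \<open>e\<close> in absolute value. Removing
  \<open>m\<close> makes the antiderivative periodic at the price of a derivative error 2e, which
  over a length of at most 2 pi gives the constant 4 pi e.\<close>

lemma mean_free_antiderivative:
  fixes h H p :: "real \<Rightarrow> real"
  assumes H: "\<And>x. (H has_real_derivative h x) (at x)" and Hper: "\<And>x. H (x + 2 * pi) = H x"
    and p: "continuous_on UNIV p" "\<And>x. p (x + 2 * pi) = p x"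
    and close: "\<And>x. x \<in> {0..2 * pi} \<Longrightarrow> \<bar>p x - h x\<bar> \<le> e"
  obtains P m where "\<And>x. (P has_real_derivative p x - m) (at x)" "\<And>x. P (x + 2 * pi) = P x"
    "\<bar>m\<bar> \<le> e" "\<And>x. x \<in> {0..2 * pi} \<Longrightarrow> \<bar>P x - H x\<bar> \<le> 4 * pi * e"
proof -
  obtain Q where Q: "\<And>x. (Q has_real_derivative p x) (at x)"
    using continuous_antiderivative_exists[OF p(1)] by blast
  define m where "m = (Q (2 * pi) - Q 0) / (2 * pi)"
  \<comment> \<open>The constants are chosen so that \<open>P\<close> and \<open>H\<close> agree at
    0, where the comparison starts.\<close>
  define P where "P x = Q x - Q 0 + H 0 - m * x" for x
  have e0: "e \<ge> 0" using close[of 0] by simp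
  have dP: "(P has_real_derivative p x - m) (at x)" for x
    unfolding P_def by (auto intro!: derivative_eq_intros Q)
  have "P (2 * pi) = P 0" by (simp add: P_def m_def)
  then have Pper: "P (x + 2 * pi) = P x" for x
    using antiderivative_periodic[OF dP, of "2 * pi" x] p(2) by simp
  have "norm ((Q (2 * pi) - H (2 * pi)) - (Q 0 - H 0)) \<le> e * norm (2 * pi - 0)"
    by (rule field_differentiable_bound[of "{0..2 * pi}" "\<lambda>x. Q x - H x" "\<lambda>x. p x - h x"])
      (auto intro!: DERIV_diff has_field_derivative_at_within[OF Q] has_field_derivative_at_within[OF H] close)
  then have "\<bar>Q (2 * pi) - Q 0\<bar> \<le> e * (2 * pi)" using Hper[of 0] by simp
  then have m: "\<bar>m\<bar> \<le> e" by (simp add: m_def abs_divide pos_divide_le_eq)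
  have "\<bar>P x - H x\<bar> \<le> 4 * pi * e" if x: "x \<in> {0..2 * pi}" for x
  proof -
    have b: "\<bar>p y - m - h y\<bar> \<le> 2 * e" if "y \<in> {0..2 * pi}" for y
      using close[OF that] m by linarith
    have "norm ((P x - H x) - (P 0 - H 0)) \<le> 2 * e * norm (x - 0)"
      by (rule field_differentiable_bound[of "{0..2 * pi}" "\<lambda>x. P x - H x" "\<lambda>x. p x - m - h x"])
        (use x in \<open>auto intro!: DERIV_diff has_field_derivative_at_within[OF dP] has_field_derivative_at_within[OF H] b\<close>)
    also have "\<dots> \<le> 2 * e * (2 * pi)" using x e0 by (intro mult_left_mono) auto
    finally show ?thesis by (simp add: P_def mult.commute mult.left_commute)
  qed
  then show ?thesis using that dP Pper m by blast
qed

lemma space_angle_measure: "space angle_measure = {0..2 * pi}"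
  by (simp add: angle_measure_def space_restrict_space)

lemma measurable_angle_measure: "f \<in> borel_measurable borel \<Longrightarrow> f \<in> borel_measurable angle_measure"
  unfolding angle_measure_def by (rule measurable_restrict_space1) simp

lemma emeasure_angle_measure: "emeasure angle_measure (space angle_measure) = ennreal (2 * pi)"
  by (simp add: angle_measure_def space_restrict_space emeasure_restrict_space)

lemma finite_angle_measure: "finite_measure angle_measure"
  by (rule finite_measureI) (simp add: emeasure_angle_measure)

lemma AE_angle_measure: "AE x in lborel. P x \<Longrightarrow> AE x in angle_measure. P x"
  unfolding angle_measure_def by (subst AE_restrict_space_iff) auto

lemma integral_angle_measure: "(\<integral>x. f x \<partial>angle_measure) = (LINT x:{0..2 * pi}|lborel. f x)"
  for f :: "real \<Rightarrow> real"
  by (simp add: angle_measure_def integral_restrict_space set_lebesgue_integral_def)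

lemma integrable_mult_bounded:
  fixes f g :: "'a \<Rightarrow> real"
  assumes f: "integrable M f" and g: "g \<in> borel_measurable M" "\<And>x. x \<in> space M \<Longrightarrow> \<bar>g x\<bar> \<le> B"
  shows "integrable M (\<lambda>x. f x * g x)"
proof (rule Bochner_Integration.integrable_bound)
  show "integrable M (\<lambda>x. B * f x)" using f by simp
  show "(\<lambda>x. f x * g x) \<in> borel_measurable M" using f g by measurable
  show "AE x in M. norm (f x * g x) \<le> norm (B * f x)"
  proof (intro AE_I2)
    fix x assume "x \<in> space M"
    then have "\<bar>g x\<bar> \<le> \<bar>B\<bar>" using g(2) by fastforce
    then show "norm (f x * g x) \<le> norm (B * f x)"
      by (simp add: abs_mult mult.commute[of "\<bar>f x\<bar>"] mult_right_mono)
  qed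
qed

lemma integrable_bounded_angle:
  fixes g :: "real \<Rightarrow> real"
  assumes "g \<in> borel_measurable angle_measure" "\<And>x. x \<in> {0..2 * pi} \<Longrightarrow> \<bar>g x\<bar> \<le> B"
  shows "integrable angle_measure g"
proof -
  interpret finite_measure angle_measure by (rule finite_angle_measure)
  show ?thesis using integrable_mult_bounded[of angle_measure "\<lambda>_. 1" g B] assms
    by (simp add: space_angle_measure)
qed

text \<open>The weak equation on one slice, multiplied by \<beta>: \<open>r\<close> stands for the
  density on the slice, \<open>a\<close> for \<beta>\<theta> times the drift.\<close>

definition weak_stationary :: "(real \<Rightarrow> real) \<Rightarrow> (real \<Rightarrow> real) \<Rightarrow> bool" where
  "weak_stationary r a \<longleftrightarrow>
     (\<forall>\<phi>. periodic_test_function \<phi> \<longrightarrow>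
        (\<integral>u. r u * (deriv (deriv \<phi>) u - a u * deriv \<phi> u) \<partial>angle_measure) = 0)"

text \<open>The drift is defined by an integral at every point, whereas the derivative of the
  potential is known to equal it only almost everywhere. This is why \<open>a\<close> is kept apart
  from \<open>deriv A\<close>.\<close>

locale circle_weight =
  fixes r a A :: "real \<Rightarrow> real" and L Ba :: real
  assumes r_int: "integrable angle_measure r"
    and a_meas: "a \<in> borel_measurable angle_measure"
    and a_bound: "\<And>u. u \<in> {0..2 * pi} \<Longrightarrow> \<bar>a u\<bar> \<le> Ba"
    and A_lip: "L-lipschitz_on UNIV A"
    and A_per: "\<And>u. A (u + 2 * pi) = A u"
    and A_deriv: "AE u in angle_measure. deriv A u = a u"
begin

lemma Ba_nonneg: "0 \<le> Ba"
  using a_bound[of 0] by simp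

text \<open>A trigonometric approximation of \<open>q\<close>, integrated twice with means removed,
  is an admissible test function. Its first two derivatives are uniformly close to \<psi> and
  \<open>q\<close>.\<close>

lemma weak_C2:
  assumes weak: "weak_stationary r a"
    and \<phi>: "\<And>x. (\<phi> has_real_derivative \<psi> x) (at x)" "\<And>x. \<phi> (x + 2 * pi) = \<phi> x"
    and \<psi>: "\<And>x. (\<psi> has_real_derivative q x) (at x)" and q: "continuous_on UNIV q"
  shows "(\<integral>u. r u * (q u - a u * \<psi> u) \<partial>angle_measure) = 0"
proof -
  have \<psi>_per: "\<psi> (x + 2 * pi) = \<psi> x" for x by (rule deriv_periodic[OF \<phi>])
  have q_per: "q (x + 2 * pi) = q x" for x by (rule deriv_periodic[OF \<psi> \<psi>_per])
  have \<psi>_cont: "continuous_on UNIV \<psi>"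
    using \<psi> by (meson DERIV_isCont continuous_at_imp_continuous_on)
  have [measurable]: "q \<in> borel_measurable angle_measure" "\<psi> \<in> borel_measurable angle_measure"
    "r \<in> borel_measurable angle_measure" "a \<in> borel_measurable angle_measure"
    using r_int a_meas by (auto intro!: measurable_angle_measure borel_measurable_continuous_onI q \<psi>_cont)
  let ?I = "\<integral>u. r u * (q u - a u * \<psi> u) \<partial>angle_measure"
  \<comment> \<open>The error in the second derivative is at most 2e (approximation and mean
    \<open>m\<close>), that in the first at most 8 pi e (4 pi e each from \<open>P\<close> and
    \<open>n\<close>); the latter is weighted by \<open>Ba\<close>.\<close>
  define C where "C = (\<integral>u. \<bar>r u\<bar> \<partial>angle_measure) * (2 + Ba * (8 * pi))"
  have key: "\<bar>?I\<bar> \<le> C * e" if e: "e > 0" for e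
  proof -
    obtain p where p: "\<And>n. times_differentiable n p" "\<And>x. p (x + 2 * pi) = p x" "\<And>x. \<bar>p x - q x\<bar> \<le> e"
      using smooth_periodic_approximation[OF q q_per e] by blast
    have p_cont: "continuous_on UNIV p"
      using p(1)[of 1] by (auto intro!: continuous_at_imp_continuous_on differentiable_imp_continuous_within)
    obtain P m where P: "\<And>x. (P has_real_derivative p x - m) (at x)" "\<And>x. P (x + 2 * pi) = P x"
      "\<bar>m\<bar> \<le> e" "\<And>x. x \<in> {0..2 * pi} \<Longrightarrow> \<bar>P x - \<psi> x\<bar> \<le> 4 * pi * e"
      using mean_free_antiderivative[OF \<psi> \<psi>_per p_cont p(2) p(3)] by blast
    have P_cont: "continuous_on UNIV P"
      using P(1) by (meson DERIV_isCont continuous_at_imp_continuous_on)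
    \<comment> \<open>Closeness of \<open>R\<close> to \<phi> itself is dropped, because only
      derivatives of the test function occur in the equation.\<close>
    obtain R n where R: "\<And>x. (R has_real_derivative P x - n) (at x)" "\<And>x. R (x + 2 * pi) = R x"
      "\<bar>n\<bar> \<le> 4 * pi * e"
    proof (rule mean_free_antiderivative[OF \<phi> P_cont P(2) P(4)])
      fix R n
      assume "\<And>x. (R has_real_derivative P x - n) (at x)" "\<And>x. R (x + 2 * pi) = R x"
        "\<bar>n\<bar> \<le> 4 * pi * e"
      then show thesis by (rule that)
    qed
    have sm: "times_differentiable k (\<lambda>x. f x - c)" if "\<And>k. times_differentiable k f" for f c k
      using times_differentiable_add[OF that times_differentiable_const[of k "- c"]] by simp
    have "times_differentiable k P" for k
      by (rule times_differentiable_antimono[OF times_differentiable_antiderivative[OF P(1) sm[OF p(1)]]])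
    then have "times_differentiable k R" for k
      by (intro times_differentiable_antimono[OF times_differentiable_antiderivative[OF R(1) sm]])
    then have test: "periodic_test_function R" using R(2) by (rule periodic_test_functionI)
    have dR: "deriv R = (\<lambda>x. P x - n)" using R(1) by (intro ext DERIV_imp_deriv)
    have "((\<lambda>x. P x - n) has_real_derivative p x - m) (at x)" for x
      using DERIV_diff[OF P(1)[of x] DERIV_const[of n]] by simp
    then have ddR: "deriv (deriv R) = (\<lambda>x. p x - m)" unfolding dR by (intro ext DERIV_imp_deriv)
    have [measurable]: "p \<in> borel_measurable angle_measure" "P \<in> borel_measurable angle_measure"
      by (auto intro!: measurable_angle_measure borel_measurable_continuous_onI p_cont P_cont)
    have 0: "(\<integral>u. r u * (p u - m - a u * (P u - n)) \<partial>angle_measure) = 0"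
    proof -
      have "(\<integral>u. r u * (deriv (deriv R) u - a u * deriv R u) \<partial>angle_measure) = 0"
        using weak test unfolding weak_stationary_def by blast
      then show ?thesis unfolding ddR unfolding dR .
    qed
    let ?d = "\<lambda>u. (q u - a u * \<psi> u) - (p u - m - a u * (P u - n))"
    have bd: "\<bar>?d u\<bar> \<le> (2 + Ba * (8 * pi)) * e" if u: "u \<in> {0..2 * pi}" for u
    proof -
      have "?d u = (q u - p u + m) + a u * (P u - \<psi> u - n)" by (simp add: algebra_simps)
      also have "\<bar>\<dots>\<bar> \<le> \<bar>q u - p u + m\<bar> + \<bar>a u\<bar> * \<bar>P u - \<psi> u - n\<bar>"
        by (metis abs_mult abs_triangle_ineq)
      also have "\<dots> \<le> 2 * e + Ba * (8 * pi * e)"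
      proof (intro add_mono mult_mono)
        show "\<bar>q u - p u + m\<bar> \<le> 2 * e" using p(3)[of u] P(3) by linarith
        show "\<bar>P u - \<psi> u - n\<bar> \<le> 8 * pi * e" using P(4)[OF u] R(3) by linarith
      qed (use a_bound[OF u] Ba_nonneg in auto)
      finally show ?thesis by (simp add: algebra_simps)
    qed
    have i1: "integrable angle_measure (\<lambda>u. r u * (p u - m - a u * (P u - n)))"
    proof -
      obtain B1 where B1: "\<And>x. \<bar>p x - m\<bar> \<le> B1"
        using periodic_bounded[OF continuous_on_diff[OF p_cont continuous_on_const[of _ m]]] p(2) by metis
      obtain B2 where B2: "B2 > 0" "\<And>x. \<bar>P x - n\<bar> \<le> B2"
        using periodic_bounded[OF continuous_on_diff[OF P_cont continuous_on_const[of _ n]]] P(2) by metis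
      have "\<bar>p u - m - a u * (P u - n)\<bar> \<le> B1 + Ba * B2" if "u \<in> {0..2 * pi}" for u
      proof -
        have "\<bar>a u * (P u - n)\<bar> \<le> Ba * B2"
          unfolding abs_mult using a_bound[OF that] B2 Ba_nonneg by (intro mult_mono) auto
        then show ?thesis using B1[of u] by linarith
      qed
      then show ?thesis by (intro integrable_mult_bounded[OF r_int]) (auto simp: space_angle_measure)
    qed
    have i2: "integrable angle_measure (\<lambda>u. r u * ?d u)"
      using bd by (intro integrable_mult_bounded[OF r_int]) (auto simp: space_angle_measure)
    have "?I = (\<integral>u. r u * ?d u + r u * (p u - m - a u * (P u - n)) \<partial>angle_measure)"
      by (rule Bochner_Integration.integral_cong) (auto simp: algebra_simps)
    then have I: "?I = (\<integral>u. r u * ?d u \<partial>angle_measure)"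
      using i1 i2 0 by (subst (asm) Bochner_Integration.integral_add) auto
    have "\<bar>?I\<bar> \<le> (\<integral>u. \<bar>r u\<bar> * ((2 + Ba * (8 * pi)) * e) \<partial>angle_measure)"
      unfolding I using i2 r_int bd
      by (intro integral_abs_bound_integral)
        (auto simp: abs_mult space_angle_measure intro!: mult_left_mono)
    then show ?thesis by (simp add: C_def)
  qed
  have C0: "C \<ge> 0" unfolding C_def using Ba_nonneg by simp
  show ?thesis
  proof (rule ccontr)
    assume "?I \<noteq> 0"
    then have "\<bar>?I\<bar> > 0" by simp
    \<comment> \<open>This value of e makes C e at most half of the integral; the 1 in the
      denominator covers C = 0.\<close>
    moreover have "\<bar>?I\<bar> \<le> C * (\<bar>?I\<bar> / (2 * (C + 1)))"
      using C0 \<open>\<bar>?I\<bar> > 0\<close> by (intro key) simp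
    moreover have "C * (\<bar>?I\<bar> / (2 * (C + 1))) \<le> \<bar>?I\<bar> / 2"
      using C0 by (simp add: field_simps)
    ultimately show False by linarith
  qed
qed

lemma weak_Lipschitz:
  assumes weak: "weak_stationary r a"
    and lip: "M-lipschitz_on UNIV \<psi>" and per: "\<And>x. \<psi> (x + 2 * pi) = \<psi> x"
    and mean: "(\<integral>u. \<psi> u \<partial>angle_measure) = 0"
  shows "(\<integral>u. r u * (deriv \<psi> u - a u * \<psi> u) \<partial>angle_measure) = 0"
proof -
  have cont: "continuous_on UNIV \<psi>" by (rule lipschitz_on_continuous_on[OF lip])
  have isc: "isCont \<psi> x" for x using cont by (simp add: continuous_on_eq_continuous_at)
  obtain \<Psi> where \<Psi>: "\<And>x. (\<Psi> has_real_derivative \<psi> x) (at x)"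
    using continuous_antiderivative_exists[OF cont] by blast
  have \<Psi>_cont: "continuous_on UNIV \<Psi>"
    using \<Psi> by (meson DERIV_isCont continuous_at_imp_continuous_on)
  obtain \<Phi> where \<Phi>: "\<And>x. (\<Phi> has_real_derivative \<Psi> x) (at x)"
    using continuous_antiderivative_exists[OF \<Psi>_cont] by blast
  obtain K where K: "K > 0" "\<And>x. \<bar>\<psi> x\<bar> \<le> K" using periodic_bounded[OF cont per] by blast
  have \<Psi>_lip: "K-lipschitz_on UNIV \<Psi>" by (rule lipschitz_if_deriv_bounded[OF \<Psi> K(2)])
  have "deriv \<Psi> = \<psi>" using \<Psi> by (intro ext DERIV_imp_deriv)
  then have "\<Psi> (2 * pi) = \<Psi> 0"
    using lipschitz_AE_has_deriv(2)[OF \<Psi>_lip, of 0 "2 * pi"] mean by (simp add: integral_angle_measure)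
  then have \<Psi>_per: "\<Psi> (x + 2 * pi) = \<Psi> x" for x
    using antiderivative_periodic[OF \<Psi>, of "2 * pi" x] per by simp
  \<comment> \<open>Quotients of \<psi> and of its first and second antiderivative, so that
    \<open>f n\<close> has derivatives \<open>s n\<close> and \<open>q n\<close>. The second
    antiderivative need not be periodic, but it gains the same constant over every period, which
    cancels in the quotient.\<close>
  define q where "q n u = real (Suc n) * (\<psi> (u + 1 / real (Suc n)) - \<psi> u)" for n u
  define s where "s n u = real (Suc n) * (\<Psi> (u + 1 / real (Suc n)) - \<Psi> u)" for n u
  define f where "f n u = real (Suc n) * (\<Phi> (u + 1 / real (Suc n)) - \<Phi> u)" for n u
  have df: "(f n has_real_derivative s n u) (at u)" for n u
    unfolding f_def s_def
    by (intro DERIV_cmult DERIV_diff \<Phi>) (use \<Phi> in \<open>simp only: DERIV_shift[symmetric]\<close>)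
  have ds: "(s n has_real_derivative q n u) (at u)" for n u
    unfolding s_def q_def
    by (intro DERIV_cmult DERIV_diff \<Psi>) (use \<Psi> in \<open>simp only: DERIV_shift[symmetric]\<close>)
  have f_per: "f n (u + 2 * pi) = f n u" for n u
  proof -
    have "\<Phi> (x + 2 * pi) = \<Phi> x + (\<Phi> (2 * pi) - \<Phi> 0)" for x
      using antiderivative_periodic[OF \<Phi> \<Psi>_per, of x] by simp
    from this[of u] this[of "u + 1 / real (Suc n)"] show ?thesis
      unfolding f_def by (simp add: add.commute add.left_commute)
  qed
  have q_cont: "continuous_on UNIV (q n)" for n
    unfolding q_def by (intro continuous_intros continuous_on_compose2[OF cont]) auto
  have s_cont: "continuous_on UNIV (s n)" for n
    unfolding s_def by (intro continuous_intros continuous_on_compose2[OF \<Psi>_cont]) auto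
  have [measurable]: "q n \<in> borel_measurable angle_measure" "s n \<in> borel_measurable angle_measure"
    "r \<in> borel_measurable angle_measure" "a \<in> borel_measurable angle_measure"
    "\<psi> \<in> borel_measurable angle_measure" "deriv \<psi> \<in> borel_measurable angle_measure" for n
    using r_int a_meas
    by (auto intro!: measurable_angle_measure borel_measurable_continuous_onI q_cont s_cont cont borel_measurable_deriv)
  have 0: "(\<integral>u. r u * (q n u - a u * s n u) \<partial>angle_measure) = 0" for n
    by (rule weak_C2[OF weak df f_per ds q_cont])
  have "(\<lambda>n. \<integral>u. r u * (q n u - a u * s n u) \<partial>angle_measure)
      \<longlonglongrightarrow> (\<integral>u. r u * (deriv \<psi> u - a u * \<psi> u) \<partial>angle_measure)"
  \<comment> \<open>Difference quotients never exceed the Lipschitz constant: \<open>M\<close>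
    bounds \<open>q n\<close> and \<open>K\<close> bounds \<open>s n\<close>, uniformly in
    n.\<close>
  proof (rule integral_dominated_convergence[where w = "\<lambda>u. \<bar>r u\<bar> * (M + Ba * K)"])
    show "integrable angle_measure (\<lambda>u. \<bar>r u\<bar> * (M + Ba * K))" using r_int by simp
    have inv: "filterlim (\<lambda>n. 1 / real (Suc n)) (at 0) sequentially"
      unfolding filterlim_at using LIMSEQ_Suc[OF lim_inverse_n'] by auto
    have lim: "(\<lambda>n. real (Suc n) * (F (u + 1 / real (Suc n)) - F u)) \<longlonglongrightarrow> d"
      if "(F has_real_derivative d) (at u)" for F d u
      using filterlim_compose[OF that[unfolded DERIV_def] inv] by (simp add: divide_simps mult.commute)
    have "AE u in angle_measure. (\<psi> has_real_derivative deriv \<psi> u) (at u)"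
      by (rule AE_angle_measure[OF lipschitz_AE_has_deriv(1)[OF lip]])
    then show "AE u in angle_measure. (\<lambda>n. r u * (q n u - a u * s n u)) \<longlonglongrightarrow> r u * (deriv \<psi> u - a u * \<psi> u)"
    proof eventually_elim
      case (elim u)
      then show ?case unfolding q_def s_def by (intro tendsto_intros lim \<Psi>)
    qed
    show "AE u in angle_measure. norm (r u * (q n u - a u * s n u)) \<le> \<bar>r u\<bar> * (M + Ba * K)" for n
    proof (intro AE_I2)
      fix u assume "u \<in> space angle_measure"
      then have u: "u \<in> {0..2 * pi}" by (simp add: space_angle_measure)
      have quot: "\<bar>real (Suc n) * (F (u + 1 / real (Suc n)) - F u)\<bar> \<le> C" if "C-lipschitz_on UNIV F" for F C
      proof -
        have "\<bar>F (u + 1 / real (Suc n)) - F u\<bar> \<le> C * (1 / real (Suc n))"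
          using lipschitz_onD[OF that, of "u + 1 / real (Suc n)" u] by (simp add: dist_real_def)
        then have "real (Suc n) * \<bar>F (u + 1 / real (Suc n)) - F u\<bar> \<le> real (Suc n) * (C * (1 / real (Suc n)))"
          by (intro mult_left_mono) simp_all
        then show ?thesis by (simp add: abs_mult)
      qed
      have qb: "\<bar>q n u\<bar> \<le> M" and sb: "\<bar>s n u\<bar> \<le> K"
        unfolding q_def s_def by (rule quot[OF lip], rule quot[OF \<Psi>_lip])
      have "\<bar>a u * s n u\<bar> \<le> Ba * K"
        unfolding abs_mult using a_bound[OF u] sb Ba_nonneg by (intro mult_mono) auto
      then have "\<bar>q n u - a u * s n u\<bar> \<le> M + Ba * K" using qb by linarith
      then show "norm (r u * (q n u - a u * s n u)) \<le> \<bar>r u\<bar> * (M + Ba * K)"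
        by (simp add: abs_mult mult_left_mono)
    qed
  qed measurable
  then show ?thesis using 0 by (simp add: LIMSEQ_const_iff)
qed


lemma A_cont: "continuous_on UNIV A"
  by (rule lipschitz_on_continuous_on[OF A_lip])

text \<open>A du Bois-Reymond argument: the product \<open>g\<close> of \<open>r\<close> and exp A
  is orthogonal to bounded mean-free functions. A single one suffices, the centred indicator of the
  set where \<open>g\<close> exceeds its mean.\<close>

lemma weak_imp_gibbs:
  assumes weak: "weak_stationary r a"
  shows "AE u in angle_measure. r u * exp (A u) = (\<integral>u. r u * exp (A u) \<partial>angle_measure) / (2 * pi)"
proof -
  interpret finite_measure angle_measure by (rule finite_angle_measure)
  obtain BA where BA: "BA > 0" "\<And>x. \<bar>A x\<bar> \<le> BA" using periodic_bounded[OF A_cont A_per] by blast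
  have mangle: "measure angle_measure (space angle_measure) = 2 * pi"
    by (simp add: measure_def emeasure_angle_measure)
  have [measurable]: "A \<in> borel_measurable borel"
    by (rule borel_measurable_continuous_onI[OF A_cont])
  have [measurable]: "A \<in> borel_measurable angle_measure" "a \<in> borel_measurable angle_measure"
    "r \<in> borel_measurable angle_measure"
    using r_int a_meas by (auto intro!: measurable_angle_measure)
  define g where "g u = r u * exp (A u)" for u
  define m where "m = (\<integral>u. g u \<partial>angle_measure) / (2 * pi)"
  have expb: "\<bar>exp (A u)\<bar> \<le> exp BA" for u using BA(2)[of u] by simp
  have g_int: "integrable angle_measure g"
    unfolding g_def by (rule integrable_mult_bounded[OF r_int]) (use expb in auto)
  have [measurable]: "g \<in> borel_measurable angle_measure" using g_int by auto
  \<comment> \<open>Testing with this set gives an integral 0 of the nonnegative excess of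
    \<open>g\<close> over \<open>m\<close>, so g \<le> m almost everywhere; since \<open>m\<close>
    is the mean, equality follows.\<close>
  define B where "B = {u \<in> space angle_measure. m < g u}"
  have B_sets[measurable]: "B \<in> sets angle_measure" unfolding B_def by measurable
  then have [measurable]: "B \<in> sets borel"
    unfolding angle_measure_def by (simp add: sets_restrict_space_iff)
  define b where "b = measure angle_measure B / (2 * pi)"
  have b01: "0 \<le> b" "b \<le> 1"
    using bounded_measure[of B] by (simp_all add: b_def mangle)
  \<comment> \<open>Subtracting the relative measure \<open>b\<close> makes \<open>h\<close>
    mean-free. On [0, 2 pi] it can differ from the centred indicator only at 2 pi, which
    \<open>reduce\<close> moves to 0.\<close>
  define h where "h x = indicator B (reduce x) - b" for x
  have [measurable]: "reduce \<in> borel_measurable borel" unfolding reduce_def by measurable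
  have h_meas[measurable]: "h \<in> borel_measurable borel" unfolding h_def by measurable
  have h_bound: "\<bar>h x\<bar> \<le> 1" for x using b01 by (auto simp: h_def indicator_def)
  have h_per: "h (x + 2 * pi) = h x" for x by (simp add: h_def reduce_periodic)
  have h_int: "set_integrable lborel {x..y} h" for x y
    unfolding set_integrable_def real_scaleR_def
    by (rule integrable_mult_bounded[OF _ _ h_bound]) (auto simp: integrable_indicator_iff emeasure_lborel_Icc_eq)
  have h_HK: "h integrable_on {x..y}" for x y by (rule set_borel_integral_eq_integral(1)[OF h_int])
  obtain \<xi> where \<xi>: "\<And>x y. x \<le> y \<Longrightarrow> \<xi> y - \<xi> x = integral {x..y} h"
    using primitive_exists[OF h_HK] by blast
  have \<xi>_der: "AE x in lborel. (\<xi> has_real_derivative h x) (at x)"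
    by (rule lebesgue_differentiation[OF h_HK \<xi>])
  have le: "\<bar>\<xi> y - \<xi> x\<bar> \<le> y - x" if "x \<le> y" for x y
  proof -
    have "norm (integral {x..y} h) \<le> integral {x..y} (\<lambda>_. 1::real)"
      by (rule Henstock_Kurzweil_Integration.integral_norm_bound_integral[OF h_HK]) (use h_bound in auto)
    then show ?thesis using \<xi>[OF that] that by simp
  qed
  have \<xi>_lip: "1-lipschitz_on UNIV \<xi>"
  proof (rule lipschitz_onI)
    show "dist (\<xi> x) (\<xi> y) \<le> 1 * dist x y" for x y
      using le[of x y] le[of y x] by (cases "x \<le> y") (auto simp: dist_real_def)
  qed simp
  have h_angle: "AE u in angle_measure. h u = indicator B u - b"
  proof -
    have "AE u in lborel. u \<noteq> 2 * pi" by (rule AE_lborel_singleton)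
    then have "AE u in angle_measure. u \<noteq> 2 * pi" by (rule AE_angle_measure)
    then show ?thesis
    proof (rule AE_mp, intro AE_I2 impI)
      fix u assume "u \<in> space angle_measure" "u \<noteq> 2 * pi"
      then show "h u = indicator B u - b" by (simp add: h_def space_angle_measure reduce_eq)
    qed
  qed
  have [measurable]: "h \<in> borel_measurable angle_measure" by (rule measurable_angle_measure[OF h_meas])
  have "(\<integral>u. h u \<partial>angle_measure) = (\<integral>u. indicator B u - b \<partial>angle_measure)"
    using h_angle by (intro integral_cong_AE) auto
  also have "\<dots> = 0"
    by (subst Bochner_Integration.integral_diff) (auto simp: b_def mangle emeasure_eq_measure)
  finally have "\<xi> (2 * pi) = \<xi> 0"
    using \<xi>[of 0 "2 * pi"] set_borel_integral_eq_integral(2)[OF h_int, of 0 "2 * pi"]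
    by (simp add: integral_angle_measure)
  \<comment> \<open>As \<xi> is differentiable only almost everywhere, periodicity comes from its
    shifted difference: this is Lipschitz with derivative 0 almost everywhere, hence constant, and
    vanishes at 0 because \<open>h\<close> has integral 0.\<close>
  have \<xi>_per: "\<xi> (x + 2 * pi) = \<xi> x" for x
  proof -
    have "AE x in distr lborel borel ((+) (2 * pi)). (\<xi> has_real_derivative h x) (at x)"
      using \<xi>_der by (simp only: lborel_distr_plus)
    then have "AE x in lborel. (\<xi> has_real_derivative h (2 * pi + x)) (at (2 * pi + x))"
      by (rule AE_distrD[rotated]) simp
    with \<xi>_der have "AE x in lborel. ((\<lambda>x. \<xi> (x + 2 * pi) - \<xi> x) has_real_derivative 0) (at x)"
    proof eventually_elim
      case (elim x)
      then have "(\<xi> has_real_derivative h x) (at (x + 2 * pi))"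
        using h_per[of x] by (simp add: add.commute)
      from DERIV_diff[OF this[THEN DERIV_shift[THEN iffD1]] elim(1)] show ?case by simp
    qed
    then have AE0: "AE y in lborel. deriv (\<lambda>x. \<xi> (x + 2 * pi) - \<xi> x) y = 0"
      by (auto simp: DERIV_imp_deriv elim!: eventually_mono)
    have lip2: "2-lipschitz_on UNIV (\<lambda>x. \<xi> (x + 2 * pi) - \<xi> x)"
    proof (rule lipschitz_onI)
      show "dist (\<xi> (x + 2 * pi) - \<xi> x) (\<xi> (y + 2 * pi) - \<xi> y) \<le> 2 * dist x y" for x y
      proof -
        have tri: "\<bar>p - q\<bar> \<le> t \<Longrightarrow> \<bar>p' - q'\<bar> \<le> t \<Longrightarrow> \<bar>p' - p - (q' - q)\<bar> \<le> 2 * t" for p q p' q' t :: real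
          by linarith
        show ?thesis
          using lipschitz_onD[OF \<xi>_lip, of x y] lipschitz_onD[OF \<xi>_lip, of "x + 2 * pi" "y + 2 * pi"]
          unfolding dist_real_def by (intro tri) simp_all
      qed
    qed simp
    have "\<xi> (v + 2 * pi) - \<xi> v = \<xi> (u + 2 * pi) - \<xi> u" if "u \<le> v" for u v
    proof -
      have "(LINT y:{u..v}|lborel. deriv (\<lambda>x. \<xi> (x + 2 * pi) - \<xi> x) y) = 0"
        unfolding set_lebesgue_integral_def
        by (rule integral_eq_zero_AE) (use AE0 in \<open>auto elim!: eventually_mono\<close>)
      then show ?thesis using lipschitz_AE_has_deriv(2)[OF lip2 that] by simp
    qed
    from this[of x 0] this[of 0 x] show ?thesis using \<open>\<xi> (2 * pi) = \<xi> 0\<close> by (cases "x \<le> 0") auto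
  qed
  have \<xi>_cont: "continuous_on UNIV \<xi>" by (rule lipschitz_on_continuous_on[OF \<xi>_lip])
  obtain B\<xi> where B\<xi>: "B\<xi> > 0" "\<And>x. \<bar>\<xi> x\<bar> \<le> B\<xi>" using periodic_bounded[OF \<xi>_cont \<xi>_per] by blast
  have [measurable]: "\<xi> \<in> borel_measurable borel" "\<xi> \<in> borel_measurable angle_measure"
    by (auto intro!: measurable_angle_measure borel_measurable_continuous_onI[OF \<xi>_cont])
  have iE: "integrable angle_measure (\<lambda>u. exp (A u))"
    by (rule integrable_bounded_angle[OF _ expb]) measurable
  have iE\<xi>: "integrable angle_measure (\<lambda>u. exp (A u) * \<xi> u)"
    by (rule integrable_mult_bounded[OF iE _ B\<xi>(2)]) measurable
  have "0 < exp (- BA) * (2 * pi)" by simp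
  also have "\<dots> = (\<integral>u. exp (- BA) \<partial>angle_measure)" by (simp add: mangle)
  also have "\<dots> \<le> (\<integral>u. exp (A u) \<partial>angle_measure)"
  proof (rule integral_mono[OF _ iE])
    show "exp (- BA) \<le> exp (A u)" for u using BA(2)[of u] by simp
  qed simp
  finally have E_pos: "0 < (\<integral>u. exp (A u) \<partial>angle_measure)" .
  \<comment> \<open>Adding a constant to \<xi> leaves its derivative alone; this constant makes
    \<psi> mean-free, as its antiderivative has to be periodic.\<close>
  define K where "K = - (\<integral>u. exp (A u) * \<xi> u \<partial>angle_measure) / (\<integral>u. exp (A u) \<partial>angle_measure)"
  define \<psi> where "\<psi> u = exp (A u) * (\<xi> u + K)" for u
  have "(\<integral>u. \<psi> u \<partial>angle_measure) = (\<integral>u. exp (A u) * \<xi> u + K * exp (A u) \<partial>angle_measure)"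
    unfolding \<psi>_def by (rule Bochner_Integration.integral_cong) (auto simp: algebra_simps)
  also have "\<dots> = 0" using iE iE\<xi> E_pos by (subst Bochner_Integration.integral_add) (auto simp: K_def)
  finally have mean: "(\<integral>u. \<psi> u \<partial>angle_measure) = 0" .
  have "\<bar>\<xi> x + K\<bar> \<le> B\<xi> + \<bar>K\<bar>" for x using B\<xi>(2)[of x] by linarith
  moreover have "(1 + 0)-lipschitz_on UNIV (\<lambda>x. \<xi> x + K)"
    by (intro lipschitz_on_add \<xi>_lip lipschitz_on_constant)
  ultimately have \<psi>_lip: "(exp BA * (1 + 0) + (B\<xi> + \<bar>K\<bar>) * (exp BA * L))-lipschitz_on UNIV \<psi>"
    unfolding \<psi>_def by (intro lipschitz_mult lipschitz_exp[OF A_lip BA(2)] expb)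
  have \<psi>_per: "\<psi> (u + 2 * pi) = \<psi> u" for u by (simp add: \<psi>_def A_per \<xi>_per)
  have "AE u in angle_measure. (\<xi> has_real_derivative h u) (at u)" by (rule AE_angle_measure[OF \<xi>_der])
  moreover have "AE u in angle_measure. (A has_real_derivative deriv A u) (at u)"
    by (rule AE_angle_measure[OF lipschitz_AE_has_deriv(1)[OF A_lip]])
  ultimately have AE_eq: "AE u in angle_measure. r u * (deriv \<psi> u - a u * \<psi> u) = g u * (indicator B u - b)"
    using A_deriv h_angle
  proof eventually_elim
    case (elim u)
    have "(\<psi> has_real_derivative exp (A u) * a u * (\<xi> u + K) + h u * exp (A u)) (at u)"
      unfolding \<psi>_def using elim(1,2,3) by (auto intro!: derivative_eq_intros)
    then have "deriv \<psi> u = exp (A u) * a u * (\<xi> u + K) + h u * exp (A u)" by (rule DERIV_imp_deriv)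
    then have "deriv \<psi> u = a u * \<psi> u + exp (A u) * (indicator B u - b)"
      using elim(4) by (simp add: \<psi>_def algebra_simps)
    then show ?case by (simp add: g_def)
  qed
  have [measurable]: "deriv \<psi> \<in> borel_measurable angle_measure" "\<psi> \<in> borel_measurable angle_measure"
    using borel_measurable_deriv[OF lipschitz_on_continuous_on[OF \<psi>_lip]]
      borel_measurable_continuous_onI[OF lipschitz_on_continuous_on[OF \<psi>_lip]]
    by (auto intro!: measurable_angle_measure)
  have ig1: "integrable angle_measure (\<lambda>u. g u * indicator B u)"
    by (rule integrable_mult_bounded[OF g_int, where B = 1]) (auto simp: indicator_def)
  have "0 = (\<integral>u. r u * (deriv \<psi> u - a u * \<psi> u) \<partial>angle_measure)"
    using weak_Lipschitz[OF weak \<psi>_lip \<psi>_per mean] by simp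
  also have "\<dots> = (\<integral>u. g u * (indicator B u - b) \<partial>angle_measure)"
    using AE_eq by (intro integral_cong_AE) auto
  also have "\<dots> = (\<integral>u. g u * indicator B u \<partial>angle_measure) - 2 * pi * m * b"
    using ig1 g_int by (simp add: right_diff_distrib m_def)
  also have "\<dots> = (\<integral>u. (g u - m) * indicator B u \<partial>angle_measure)"
    using ig1 by (simp add: left_diff_distrib b_def emeasure_eq_measure)
  finally have z: "(\<integral>u. (g u - m) * indicator B u \<partial>angle_measure) = 0" by simp
  have "AE u in angle_measure. (g u - m) * indicator B u = 0"
  proof (rule integral_nonneg_eq_0_iff_AE[THEN iffD1, OF _ _ z])
    show "integrable angle_measure (\<lambda>u. (g u - m) * indicator B u)"
      using ig1 by (simp add: left_diff_distrib emeasure_eq_measure)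
  qed (auto simp: B_def indicator_def)
  then have le_m: "AE u in angle_measure. 0 \<le> m - g u"
    by (rule AE_mp) (intro AE_I2 impI, auto simp: B_def indicator_def split: if_splits)
  have z2: "(\<integral>u. m - g u \<partial>angle_measure) = 0"
    using g_int by (simp add: m_def mangle)
  have "AE u in angle_measure. m - g u = 0"
    by (rule integral_nonneg_eq_0_iff_AE[THEN iffD1, OF _ le_m z2]) (use g_int in auto)
  then show ?thesis unfolding m_def g_def by (auto elim!: eventually_mono)
qed

text \<open>Multiplied by exp (- A), the expression \<phi>'' - a \<phi>' is almost everywhere the
  derivative of the periodic Lipschitz function exp (- A) \<phi>', whose integral over a period
  vanishes.\<close>

lemma gibbs_imp_weak:
  assumes gibbs: "AE u in angle_measure. r u = c * exp (- A u)"
  shows "weak_stationary r a"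
  unfolding weak_stationary_def
proof (intro allI impI)
  fix \<phi> assume \<phi>: "periodic_test_function \<phi>"
  note D = periodic_test_functionD[OF \<phi>]
  obtain BA where BA: "BA > 0" "\<And>x. \<bar>A x\<bar> \<le> BA" using periodic_bounded[OF A_cont A_per] by blast
  obtain B1 where B1: "B1 > 0" "\<And>x. \<bar>deriv \<phi> x\<bar> \<le> B1" using periodic_bounded[OF D(3,6)] by blast
  obtain B2 where B2: "B2 > 0" "\<And>x. \<bar>deriv (deriv \<phi>) x\<bar> \<le> B2" using periodic_bounded[OF D(4,7)] by blast
  define f where "f u = exp (- A u) * deriv \<phi> u" for u
  have mA: "L-lipschitz_on UNIV (\<lambda>u. - A u)" using A_lip by simp
  have f_lip: "(exp BA * B2 + B1 * (exp BA * L))-lipschitz_on UNIV f"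
    unfolding f_def
  proof (rule lipschitz_mult)
    show "(exp BA * L)-lipschitz_on UNIV (\<lambda>x. exp (- A x))"
      by (rule lipschitz_exp[OF mA]) (use BA in simp)
    show "\<bar>exp (- A x)\<bar> \<le> exp BA" for x using BA(2)[of x] by simp
    show "B2-lipschitz_on UNIV (deriv \<phi>)" by (rule lipschitz_if_deriv_bounded[OF D(2) B2(2)])
    show "\<bar>deriv \<phi> x\<bar> \<le> B1" for x by (rule B1(2))
  qed
  have [measurable]: "deriv f \<in> borel_measurable angle_measure" "deriv \<phi> \<in> borel_measurable angle_measure"
    "deriv (deriv \<phi>) \<in> borel_measurable angle_measure" "r \<in> borel_measurable angle_measure"
    "a \<in> borel_measurable angle_measure"
    using r_int a_meas borel_measurable_deriv[OF lipschitz_on_continuous_on[OF f_lip]]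
      borel_measurable_continuous_onI[OF D(3)] borel_measurable_continuous_onI[OF D(4)]
    by (auto intro!: measurable_angle_measure)
  have "AE u in angle_measure. (A has_real_derivative deriv A u) (at u)"
    by (rule AE_angle_measure[OF lipschitz_AE_has_deriv(1)[OF A_lip]])
  then have "AE u in angle_measure. r u * (deriv (deriv \<phi>) u - a u * deriv \<phi> u) = c * deriv f u"
    using A_deriv gibbs
  proof eventually_elim
    case (elim u)
    have "(f has_real_derivative exp (- A u) * (- a u) * deriv \<phi> u + deriv (deriv \<phi>) u * exp (- A u)) (at u)"
      unfolding f_def using elim(1,2) D(2)[of u] by (auto intro!: derivative_eq_intros)
    then have "deriv f u = exp (- A u) * (- a u) * deriv \<phi> u + deriv (deriv \<phi>) u * exp (- A u)"
      by (rule DERIV_imp_deriv)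
    then show ?case using elim(3) by (simp only:) (simp add: algebra_simps)
  qed
  then have "(\<integral>u. r u * (deriv (deriv \<phi>) u - a u * deriv \<phi> u) \<partial>angle_measure) = (\<integral>u. c * deriv f u \<partial>angle_measure)"
    by (intro integral_cong_AE) auto
  also have "\<dots> = c * (f (2 * pi) - f 0)"
    using lipschitz_AE_has_deriv(2)[OF f_lip, of 0 "2 * pi"] by (simp add: integral_angle_measure)
  also have "f (2 * pi) = f 0" using A_per[of 0] D(6)[of 0] by (simp add: f_def)
  finally show "(\<integral>u. r u * (deriv (deriv \<phi>) u - a u * deriv \<phi> u) \<partial>angle_measure) = 0" by simp
qed

end

subsection \<open>The phase space and the interaction potential\<close>

lemma space_label_measure: "space label_measure = {0..1}"
  by (simp add: label_measure_def space_restrict_space)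

lemma prob_space_label_measure: "prob_space label_measure"
  by (rule prob_spaceI) (simp add: label_measure_def space_restrict_space emeasure_restrict_space)

interpretation angle: finite_measure angle_measure
  by (rule finite_angle_measure)

interpretation label: prob_space label_measure
  by (rule prob_space_label_measure)

interpretation phase: pair_sigma_finite angle_measure label_measure
  ..

lemma space_phase_measure: "space phase_measure = {0..2 * pi} \<times> {0..1}"
  by (simp add: phase_measure_def space_pair_measure space_angle_measure space_label_measure)

lemma finite_phase_measure: "finite_measure phase_measure"
proof (rule finite_measureI)
  have "emeasure phase_measure (space angle_measure \<times> space label_measure) = ennreal (2 * pi)"
    unfolding phase_measure_def
    by (subst label.emeasure_pair_measure_Times) (auto simp: emeasure_angle_measure label.emeasure_space_1)
  then show "emeasure phase_measure (space phase_measure) \<noteq> \<infinity>"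
    by (simp add: phase_measure_def space_pair_measure)
qed

interpretation phase_space: finite_measure phase_measure
  by (rule finite_phase_measure)

lemma ident_angle_measure[measurable]: "(\<lambda>x. x) \<in> borel_measurable angle_measure"
  by (rule measurable_angle_measure) simp

lemma ident_label_measure[measurable]: "(\<lambda>x. x) \<in> borel_measurable label_measure"
  unfolding label_measure_def by (rule measurable_restrict_space1) simp

lemma fst_phase_angle: "fst \<in> measurable phase_measure angle_measure"
  and snd_phase_label: "snd \<in> measurable phase_measure label_measure"
  unfolding phase_measure_def by measurable

lemma fst_phase[measurable]: "fst \<in> borel_measurable phase_measure"
  by (rule measurable_compose[OF fst_phase_angle ident_angle_measure])

lemma snd_phase[measurable]: "snd \<in> borel_measurable phase_measure"
  by (rule measurable_compose[OF snd_phase_label ident_label_measure])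

lemma nn_integral_phase:
  assumes "f \<in> borel_measurable phase_measure"
  shows "(\<integral>\<^sup>+z. f z \<partial>phase_measure) = (\<integral>\<^sup>+x. \<integral>\<^sup>+u. f (u, x) \<partial>angle_measure \<partial>label_measure)"
  using phase.nn_integral_snd[of f] assms by (simp add: phase_measure_def)

text \<open>The product lists the angle first, but the weak equation fixes the label first; Fubini
  exchanges the two quantifiers.\<close>

lemma AE_phase_iff:
  assumes "{z \<in> space phase_measure. P z} \<in> sets phase_measure"
  shows "(AE z in phase_measure. P z) \<longleftrightarrow> (AE x in label_measure. AE u in angle_measure. P (u, x))"
proof -
  have "(AE z in phase_measure. P z) \<longleftrightarrow> (AE u in angle_measure. AE x in label_measure. P (u, x))"
    using phase.AE_pair_iff[of "\<lambda>u x. P (u, x)"] assms unfolding phase_measure_def by simp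
  also have "\<dots> \<longleftrightarrow> (AE x in label_measure. AE u in angle_measure. P (u, x))"
    using phase.AE_commute[of "\<lambda>u x. P (u, x)"] assms unfolding phase_measure_def by simp
  finally show ?thesis .
qed

lemma measurable_slice:
  assumes "f \<in> borel_measurable phase_measure" and "x \<in> {0..1}"
  shows "(\<lambda>u. f (u, x)) \<in> borel_measurable angle_measure"
  using measurable_compose[OF measurable_Pair2'[of x label_measure angle_measure] assms(1)[unfolded phase_measure_def]]
    assms(2) by (simp add: space_label_measure)

text \<open>Tonelli turns unit mass on the slices into the Lebesgue marginal. The second moment is
  finite because u is at most 2 pi.\<close>

lemma P2L_densityI:
  assumes m[measurable]: "\<rho> \<in> borel_measurable phase_measure"
    and nn: "\<And>z. z \<in> space phase_measure \<Longrightarrow> 0 \<le> \<rho> z"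
    and one: "\<And>x. x \<in> {0..1} \<Longrightarrow> (\<integral>\<^sup>+u. ennreal (\<rho> (u, x)) \<partial>angle_measure) = 1"
  shows "P2L_density \<rho>"
proof -
  let ?M = "density phase_measure (\<lambda>z. ennreal (\<rho> z))"
  have em: "emeasure (distr ?M label_measure snd) A = emeasure label_measure A" if [measurable]: "A \<in> sets label_measure" for A
  proof -
    note snd_phase_label[measurable]
    have "emeasure (distr ?M label_measure snd) A = (\<integral>\<^sup>+z. ennreal (\<rho> z) * indicator (snd -` A \<inter> space phase_measure) z \<partial>phase_measure)"
      by (subst emeasure_distr) (auto intro!: emeasure_density)
    also have "\<dots> = (\<integral>\<^sup>+z. ennreal (\<rho> z) * indicator A (snd z) \<partial>phase_measure)"
      by (rule nn_integral_cong) (auto simp: indicator_def)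
    also have "\<dots> = (\<integral>\<^sup>+x. \<integral>\<^sup>+u. ennreal (\<rho> (u, x)) * indicator A x \<partial>angle_measure \<partial>label_measure)"
      by (subst nn_integral_phase) auto
    also have "\<dots> = (\<integral>\<^sup>+x. indicator A x \<partial>label_measure)"
    proof (rule nn_integral_cong)
      fix x assume "x \<in> space label_measure"
      then have x: "x \<in> {0..1}" by (simp add: space_label_measure)
      have "(\<integral>\<^sup>+u. ennreal (\<rho> (u, x)) * indicator A x \<partial>angle_measure) = (\<integral>\<^sup>+u. ennreal (\<rho> (u, x)) \<partial>angle_measure) * indicator A x"
        using measurable_slice[OF m x] by (intro nn_integral_multc) auto
      then show "(\<integral>\<^sup>+u. ennreal (\<rho> (u, x)) * indicator A x \<partial>angle_measure) = indicator A x"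
        using one[OF x] by simp
    qed
    finally show ?thesis by simp
  qed
  have snd_M: "snd \<in> measurable ?M label_measure" using snd_phase_label by simp
  have distr: "distr ?M label_measure snd = label_measure"
    by (rule measure_eqI) (use em in auto)
  \<comment> \<open>The total mass is read off from the marginal, which is already known to be a
    probability.\<close>
  then have "prob_space (distr ?M label_measure snd)" using prob_space_label_measure by simp
  then have prob: "prob_space ?M" by (rule prob_space_distrD[OF snd_M])
  interpret M: prob_space ?M by (rule prob)
  have "integrable ?M (\<lambda>(u, x). u\<^sup>2)"
  proof (rule M.integrable_const_bound)
    show "AE z in ?M. norm (case z of (u, x) \<Rightarrow> u\<^sup>2) \<le> (2 * pi)\<^sup>2"
    proof (rule AE_I2)
      fix z assume "z \<in> space ?M"
      then have "0 \<le> fst z" "fst z \<le> 2 * pi" by (auto simp: space_phase_measure)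
      then have "(fst z)\<^sup>2 \<le> (2 * pi)\<^sup>2" by (intro power_mono)
      then show "norm (case z of (u, x) \<Rightarrow> u\<^sup>2) \<le> (2 * pi)\<^sup>2" by (simp only: case_prod_beta real_norm_def abs_power2)
    qed
    show "(\<lambda>(u, x). u\<^sup>2) \<in> borel_measurable ?M"
      by (simp add: case_prod_beta)
  qed
  then show ?thesis using prob distr nn unfolding P2L_density_def P2L_def by auto
qed

lemma P2L_density_facts:
  assumes "P2L_density \<rho>"
  shows "\<rho> \<in> borel_measurable phase_measure"
    and "\<And>z. z \<in> space phase_measure \<Longrightarrow> 0 \<le> \<rho> z"
    and "integrable phase_measure \<rho>" and "(\<integral>z. \<rho> z \<partial>phase_measure) = 1"
    and "integrable label_measure f \<Longrightarrow> integrable phase_measure (\<lambda>z. \<rho> z * f (snd z))"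
    and "integrable label_measure f \<Longrightarrow> (\<integral>z. \<rho> z * f (snd z) \<partial>phase_measure) = (\<integral>x. f x \<partial>label_measure)"
    and "AE x in label_measure. integrable angle_measure (\<lambda>u. \<rho> (u, x)) \<and> (\<integral>u. \<rho> (u, x) \<partial>angle_measure) = 1"
proof -
  let ?M = "density phase_measure (\<lambda>z. ennreal (\<rho> z))"
  show m[measurable]: "\<rho> \<in> borel_measurable phase_measure"
    and nn: "\<And>z. z \<in> space phase_measure \<Longrightarrow> 0 \<le> \<rho> z"
    using assms unfolding P2L_density_def by auto
  have nnAE: "AE z in phase_measure. 0 \<le> \<rho> z" using nn by (intro AE_I2)
  have prob: "prob_space ?M" and distr: "distr ?M label_measure snd = label_measure"
    using assms unfolding P2L_density_def P2L_def by auto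
  have sM: "snd \<in> measurable ?M label_measure" using snd_phase_label by simp
  have fi: "integrable phase_measure (\<lambda>z. \<rho> z * f (snd z))"
    and fe: "(\<integral>z. \<rho> z * f (snd z) \<partial>phase_measure) = (\<integral>x. f x \<partial>label_measure)"
    if f: "integrable label_measure f" for f :: "real \<Rightarrow> real"
  proof -
    have fm: "(\<lambda>z. f (snd z)) \<in> borel_measurable phase_measure"
      by (rule measurable_compose[OF snd_phase_label]) (use f in auto)
    have "integrable (distr ?M label_measure snd) f" using f distr by simp
    then have "integrable ?M (\<lambda>z. f (snd z))" by (rule integrable_distr[OF sM])
    then show "integrable phase_measure (\<lambda>z. \<rho> z * f (snd z))"
      using integrable_density[OF fm m nnAE] by simp
    have "(\<integral>x. f x \<partial>label_measure) = (\<integral>x. f x \<partial>distr ?M label_measure snd)" using distr by simp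
    also have "\<dots> = (\<integral>z. f (snd z) \<partial>?M)" by (rule integral_distr[OF sM]) (use f in auto)
    also have "\<dots> = (\<integral>z. \<rho> z * f (snd z) \<partial>phase_measure)"
      using integral_density[OF fm m nnAE] by simp
    finally show "(\<integral>z. \<rho> z * f (snd z) \<partial>phase_measure) = (\<integral>x. f x \<partial>label_measure)" ..
  qed
  show "integrable label_measure f \<Longrightarrow> integrable phase_measure (\<lambda>z. \<rho> z * f (snd z))"
    by (rule fi)
  show "integrable label_measure f \<Longrightarrow> (\<integral>z. \<rho> z * f (snd z) \<partial>phase_measure) = (\<integral>x. f x \<partial>label_measure)"
    by (rule fe)
  show int: "integrable phase_measure \<rho>" and "(\<integral>z. \<rho> z \<partial>phase_measure) = 1"
    using fi[of "\<lambda>_. 1"] fe[of "\<lambda>_. 1"] label.prob_space by auto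
  define g where "g x = (\<integral>\<^sup>+u. ennreal (\<rho> (u, x)) \<partial>angle_measure)" for x
  have g_meas: "g \<in> borel_measurable label_measure"
  proof -
    have [measurable]: "\<rho> \<in> borel_measurable (angle_measure \<Otimes>\<^sub>M label_measure)"
      using m by (simp add: phase_measure_def)
    show ?thesis unfolding g_def by (rule angle.borel_measurable_nn_integral) measurable
  qed
  \<comment> \<open>The slice masses \<open>g\<close> are a density of the marginal with respect to
    Lebesgue measure, as is 1; densities are unique almost everywhere.\<close>
  have "density label_measure g = density label_measure (\<lambda>_. 1)"
  proof (rule measure_eqI)
    fix A assume "A \<in> sets (density label_measure g)"
    then have [measurable]: "A \<in> sets label_measure" by simp
    note snd_phase_label[measurable]
    have "emeasure (density label_measure g) A = (\<integral>\<^sup>+x. g x * indicator A x \<partial>label_measure)"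
      using g_meas by (intro emeasure_density) auto
    also have "\<dots> = (\<integral>\<^sup>+x. \<integral>\<^sup>+u. ennreal (\<rho> (u, x)) * indicator A x \<partial>angle_measure \<partial>label_measure)"
    proof (rule nn_integral_cong)
      fix x assume "x \<in> space label_measure"
      then have x: "x \<in> {0..1}" by (simp add: space_label_measure)
      show "g x * indicator A x = (\<integral>\<^sup>+u. ennreal (\<rho> (u, x)) * indicator A x \<partial>angle_measure)"
        unfolding g_def using measurable_slice[OF m x] by (intro nn_integral_multc[symmetric]) auto
    qed
    also have "\<dots> = (\<integral>\<^sup>+z. ennreal (\<rho> z) * indicator A (snd z) \<partial>phase_measure)"
      by (subst nn_integral_phase) auto
    also have "\<dots> = (\<integral>\<^sup>+z. ennreal (\<rho> z) * indicator (snd -` A \<inter> space phase_measure) z \<partial>phase_measure)"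
      by (rule nn_integral_cong) (auto simp: indicator_def)
    also have "\<dots> = emeasure (distr ?M label_measure snd) A"
      by (subst emeasure_distr) (auto intro!: emeasure_density[symmetric])
    also have "\<dots> = emeasure (density label_measure (\<lambda>_. 1)) A" using distr by (simp add: density_1)
    finally show "emeasure (density label_measure g) A = emeasure (density label_measure (\<lambda>_. 1)) A" .
  qed simp
  then have "AE x in label_measure. g x = 1"
    using label.density_unique_iff[of g "\<lambda>_. 1"] g_meas by simp
  then show "AE x in label_measure. integrable angle_measure (\<lambda>u. \<rho> (u, x)) \<and> (\<integral>u. \<rho> (u, x) \<partial>angle_measure) = 1"
  proof (rule AE_mp, intro AE_I2 impI)
    fix x assume "x \<in> space label_measure" and gx: "g x = 1"
    then have x: "x \<in> {0..1}" by (simp add: space_label_measure)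
    have "has_bochner_integral angle_measure (\<lambda>u. \<rho> (u, x)) 1"
    proof (rule has_bochner_integral_nn_integral)
      show "(\<lambda>u. \<rho> (u, x)) \<in> borel_measurable angle_measure" by (rule measurable_slice[OF m x])
      show "AE u in angle_measure. 0 \<le> \<rho> (u, x)"
        using x by (intro AE_I2 nn) (simp add: space_phase_measure space_angle_measure)
      show "(\<integral>\<^sup>+u. ennreal (\<rho> (u, x)) \<partial>angle_measure) = ennreal 1" using gx by (simp add: g_def)
    qed simp
    then show "integrable angle_measure (\<lambda>u. \<rho> (u, x)) \<and> (\<integral>u. \<rho> (u, x) \<partial>angle_measure) = 1"
      by (simp add: has_bochner_integral_iff)
  qed
qed

text \<open>It holds at points without a derivative as well: both sides choose from the same
  predicate.\<close>

lemma deriv_shift: "deriv (\<lambda>s. f (s + c)) s = deriv f (s + c)" for f :: "real \<Rightarrow> real"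
  unfolding deriv_def DERIV_shift[symmetric] by simp

text \<open>Here \<open>w\<close> stands for \<open>W\<close> extended by 0 from the unit square.
  Bounds and symmetry then hold on the whole plane, and measurability refers to the Borel
  product.\<close>

locale interaction_kernel =
  fixes w :: "real \<Rightarrow> real \<Rightarrow> real" and D :: "real \<Rightarrow> real" and LD :: real
  assumes w_meas: "(\<lambda>(x, y). w x y) \<in> borel_measurable (borel \<Otimes>\<^sub>M borel)"
    and w_nonneg: "\<And>x y. 0 \<le> w x y" and w_le1: "\<And>x y. w x y \<le> 1"
    and w_sym: "\<And>x y. w x y = w y x"
    and D_lip: "LD-lipschitz_on UNIV D"
    and D_even: "\<And>u. D (- u) = D u" and D_per: "\<And>u. D (u + 2 * pi) = D u"
begin

definition MD where "MD = (SOME B. \<forall>u. \<bar>D u\<bar> \<le> B)"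
definition BD where "BD = (SOME B. \<forall>u. \<bar>deriv D u\<bar> \<le> B)"

lemma D_cont: "continuous_on UNIV D"
  by (rule lipschitz_on_continuous_on[OF D_lip])

lemma D_meas[measurable]: "D \<in> borel_measurable borel"
  by (rule borel_measurable_continuous_onI[OF D_cont])

lemma dD_meas[measurable]: "deriv D \<in> borel_measurable borel"
  by (rule borel_measurable_deriv[OF D_cont])

lemma D_bound: "\<bar>D u\<bar> \<le> MD"
proof -
  have "\<exists>B. \<forall>u. \<bar>D u\<bar> \<le> B" using periodic_bounded[OF D_cont D_per] by metis
  from someI_ex[OF this] show ?thesis unfolding MD_def by blast
qed

lemma dD_bound: "\<bar>deriv D u\<bar> \<le> BD"
proof -
  have "\<exists>B. \<forall>u. \<bar>deriv D u\<bar> \<le> B" using lipschitz_deriv_bounded[OF D_lip] by metis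
  from someI_ex[OF this] show ?thesis unfolding BD_def by blast
qed

lemma w_meas'[measurable (raw)]:
  assumes "f \<in> borel_measurable M" "g \<in> borel_measurable M"
  shows "(\<lambda>z. w (f z) (g z)) \<in> borel_measurable M"
  using measurable_compose[OF measurable_Pair[OF assms] w_meas] by simp

lemma w_bound: "\<bar>w x y\<bar> \<le> 1"
  using w_nonneg[of x y] w_le1[of x y] by simp

definition potential :: "(real \<times> real \<Rightarrow> real) \<Rightarrow> real \<Rightarrow> real \<Rightarrow> real" where
  "potential f u x = (\<integral>z. f z * (w x (snd z) * D (u - fst z)) \<partial>phase_measure)"

text \<open>The potential differentiated formally under the integral sign. It exists at every u,
  though it is the true derivative only almost everywhere.\<close>

definition slope :: "(real \<times> real \<Rightarrow> real) \<Rightarrow> real \<Rightarrow> real \<Rightarrow> real" where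
  "slope f u x = (\<integral>z. f z * (w x (snd z) * deriv D (u - fst z)) \<partial>phase_measure)"

lemma wD_bound: "\<bar>w x y * D u\<bar> \<le> MD"
  using mult_mono[OF w_bound[of x y] D_bound[of u]] by (simp add: abs_mult)

lemma wdD_bound: "\<bar>w x y * deriv D u\<bar> \<le> BD"
  using mult_mono[OF w_bound[of x y] dD_bound[of u]] by (simp add: abs_mult)

lemma potential_integrable:
  "integrable phase_measure f \<Longrightarrow> integrable phase_measure (\<lambda>z. f z * (w x (snd z) * D (u - fst z)))"
  by (rule integrable_mult_bounded[OF _ _ wD_bound]) measurable

lemma slope_integrable:
  "integrable phase_measure f \<Longrightarrow> integrable phase_measure (\<lambda>z. f z * (w x (snd z) * deriv D (u - fst z)))"
  by (rule integrable_mult_bounded[OF _ _ wdD_bound]) measurable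

lemma potential_measurable:
  assumes [measurable]: "f \<in> borel_measurable phase_measure"
  shows "(\<lambda>z. potential f (fst z) (snd z)) \<in> borel_measurable phase_measure"
  unfolding potential_def
  by (rule phase_space.borel_measurable_lebesgue_integral) measurable

lemma slope_measurable:
  assumes [measurable]: "f \<in> borel_measurable phase_measure"
  shows "(\<lambda>u. slope f u x) \<in> borel_measurable borel"
  unfolding slope_def
  by (rule phase_space.borel_measurable_lebesgue_integral) measurable

context
  fixes f :: "real \<times> real \<Rightarrow> real"
  assumes f: "integrable phase_measure f"
begin

lemma potential_lipschitz: "(LD * (\<integral>z. \<bar>f z\<bar> \<partial>phase_measure))-lipschitz_on UNIV (\<lambda>u. potential f u x)"
proof (rule lipschitz_onI)
  have LD: "0 \<le> LD" using lipschitz_on_nonneg[OF D_lip] .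
  then show "0 \<le> LD * (\<integral>z. \<bar>f z\<bar> \<partial>phase_measure)" by simp
  fix u v
  have "potential f u x - potential f v x
      = (\<integral>z. f z * (w x (snd z) * D (u - fst z)) - f z * (w x (snd z) * D (v - fst z)) \<partial>phase_measure)"
    unfolding potential_def using potential_integrable[OF f] by (intro Bochner_Integration.integral_diff[symmetric])
  also have "\<bar>\<dots>\<bar> \<le> (\<integral>z. \<bar>f z\<bar> * (LD * \<bar>u - v\<bar>) \<partial>phase_measure)"
  proof (rule integral_abs_bound_integral)
    show "\<bar>f z * (w x (snd z) * D (u - fst z)) - f z * (w x (snd z) * D (v - fst z))\<bar> \<le> \<bar>f z\<bar> * (LD * \<bar>u - v\<bar>)" for z
    proof -
      have "\<bar>w x (snd z)\<bar> * \<bar>D (u - fst z) - D (v - fst z)\<bar> \<le> 1 * (LD * \<bar>u - v\<bar>)"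
        using lipschitz_onD[OF D_lip, of "u - fst z" "v - fst z"] w_bound
        by (intro mult_mono) (auto simp: dist_real_def)
      then have "\<bar>f z\<bar> * (\<bar>w x (snd z)\<bar> * \<bar>D (u - fst z) - D (v - fst z)\<bar>) \<le> \<bar>f z\<bar> * (LD * \<bar>u - v\<bar>)"
        by (intro mult_left_mono) auto
      then show ?thesis by (simp add: abs_mult[symmetric] right_diff_distrib)
    qed
  qed (use f potential_integrable[OF f] in auto)
  finally show "dist (potential f u x) (potential f v x) \<le> LD * (\<integral>z. \<bar>f z\<bar> \<partial>phase_measure) * dist u v"
    by (simp add: dist_real_def algebra_simps)
qed

lemma potential_periodic: "potential f (u + 2 * pi) x = potential f u x"
proof -
  have "D (u + 2 * pi - v) = D (u - v)" for v
    using D_per[of "u - v"] by (simp add: algebra_simps)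
  then show ?thesis by (simp add: potential_def)
qed

lemma potential_bound: "\<bar>potential f u x\<bar> \<le> MD * (\<integral>z. \<bar>f z\<bar> \<partial>phase_measure)"
proof -
  have "\<bar>potential f u x\<bar> \<le> (\<integral>z. \<bar>f z\<bar> * MD \<partial>phase_measure)"
    unfolding potential_def
    by (rule integral_abs_bound_integral)
      (use f potential_integrable[OF f] wD_bound in \<open>auto simp: abs_mult intro!: mult_left_mono\<close>)
  then show ?thesis by (simp add: mult.commute)
qed

lemma slope_bound: "\<bar>slope f u x\<bar> \<le> BD * (\<integral>z. \<bar>f z\<bar> \<partial>phase_measure)"
proof -
  have "\<bar>slope f u x\<bar> \<le> (\<integral>z. \<bar>f z\<bar> * BD \<partial>phase_measure)"
    unfolding slope_def
    by (rule integral_abs_bound_integral)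
      (use f slope_integrable[OF f] wdD_bound in \<open>auto simp: abs_mult intro!: mult_left_mono\<close>)
  then show ?thesis by (simp add: mult.commute)
qed

lemma slope_set_integrable: "set_integrable lborel {a..b} (\<lambda>s. slope f s x)"
  unfolding set_integrable_def real_scaleR_def
  by (rule integrable_mult_bounded[OF _ _ slope_bound])
    (use slope_measurable[of f x] f in \<open>auto simp: integrable_indicator_iff emeasure_lborel_Icc_eq\<close>)

text \<open>The points where \<open>D\<close> fails to be differentiable move with the integration
  variable, so the formal derivative is justified in integrated form: Fubini first, then the
  fundamental theorem for each translate of \<open>D\<close>.\<close>

lemma slope_integral:
  assumes "a \<le> b"
  shows "(LINT s:{a..b}|lborel. slope f s x) = potential f b x - potential f a x"
proof -
  interpret P: pair_sigma_finite lborel phase_measure ..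
  define F where "F s z = indicator {a..b} s * (f z * (w x (snd z) * deriv D (s - fst z)))" for s :: real and z
  have [measurable]: "f \<in> borel_measurable phase_measure" using f by auto
  have F_int: "integrable (lborel \<Otimes>\<^sub>M phase_measure) (\<lambda>(s, z). F s z)"
  proof -
    have 1: "integrable (lborel \<Otimes>\<^sub>M phase_measure) (\<lambda>p. indicator {a..b} (fst p) * f (snd p))"
    proof (rule P.Fubini_integrable)
      have "integrable lborel (\<lambda>s. indicator {a..b} s * (\<integral>z. \<bar>f z\<bar> \<partial>phase_measure) :: real)"
        by (rule integrable_mult_left) (simp add: integrable_indicator_iff emeasure_lborel_Icc_eq)
      then show "integrable lborel (\<lambda>s. \<integral>z. norm (indicator {a..b} (fst (s, z)) * f (snd (s, z))) \<partial>phase_measure)"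
        by (simp add: abs_mult)
    qed (use f in auto)
    have "integrable (lborel \<Otimes>\<^sub>M phase_measure)
        (\<lambda>p. indicator {a..b} (fst p) * f (snd p) * (w x (snd (snd p)) * deriv D (fst p - fst (snd p))))"
      by (rule integrable_mult_bounded[OF 1 _ wdD_bound]) measurable
    then show ?thesis by (simp add: F_def case_prod_unfold mult.assoc)
  qed
  have "(LINT s:{a..b}|lborel. slope f s x) = (\<integral>s. (\<integral>z. F s z \<partial>phase_measure) \<partial>lborel)"
    by (simp add: set_lebesgue_integral_def slope_def F_def)
  also have "\<dots> = (\<integral>z. (\<integral>s. F s z \<partial>lborel) \<partial>phase_measure)"
    using P.Fubini_integral[OF F_int] by simp
  also have "\<dots> = (\<integral>z. f z * (w x (snd z) * D (b - fst z)) - f z * (w x (snd z) * D (a - fst z)) \<partial>phase_measure)"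
  proof (rule Bochner_Integration.integral_cong[OF refl])
    fix z :: "real \<times> real"
    have "LD-lipschitz_on UNIV (\<lambda>s. D (s + - fst z))"
    proof (rule lipschitz_onI)
      show "dist (D (s + - fst z)) (D (t + - fst z)) \<le> LD * dist s t" for s t
        using lipschitz_onD[OF D_lip, of "s + - fst z" "t + - fst z"] by (simp add: dist_real_def)
    qed (rule lipschitz_on_nonneg[OF D_lip])
    from lipschitz_AE_has_deriv(2)[OF this assms]
    have "(LINT s:{a..b}|lborel. deriv D (s - fst z)) = D (b - fst z) - D (a - fst z)"
      by (simp only: deriv_shift) simp
    moreover have "(\<integral>s. F s z \<partial>lborel) = f z * w x (snd z) * (LINT s:{a..b}|lborel. deriv D (s - fst z))"
    proof -
      have "(\<integral>s. F s z \<partial>lborel)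
          = (\<integral>s. f z * w x (snd z) * (indicator {a..b} s *\<^sub>R deriv D (s - fst z)) \<partial>lborel)"
        by (rule Bochner_Integration.integral_cong) (auto simp: F_def)
      then show ?thesis by (simp only: integral_mult_right_zero set_lebesgue_integral_def)
    qed
    ultimately show "(\<integral>s. F s z \<partial>lborel) = f z * (w x (snd z) * D (b - fst z)) - f z * (w x (snd z) * D (a - fst z))"
      by (simp only: right_diff_distrib mult.assoc)
  qed
  also have "\<dots> = potential f b x - potential f a x"
    unfolding potential_def using potential_integrable[OF f] by (intro Bochner_Integration.integral_diff)
  finally show ?thesis .
qed

lemma potential_AE_deriv: "AE u in lborel. deriv (\<lambda>u. potential f u x) u = slope f u x"
proof -
  have "AE u in lborel. ((\<lambda>u. potential f u x) has_real_derivative slope f u x) (at u)"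
  proof (rule lebesgue_differentiation)
    show "(\<lambda>u. slope f u x) integrable_on {a..b}" for a b
      by (rule set_borel_integral_eq_integral(1)[OF slope_set_integrable])
    show "potential f b x - potential f a x = integral {a..b} (\<lambda>u. slope f u x)" if "a \<le> b" for a b
      using slope_integral[OF that] set_borel_integral_eq_integral(2)[OF slope_set_integrable] by simp
  qed
  then show ?thesis by (auto simp: DERIV_imp_deriv elim!: eventually_mono)
qed

end

end

subsection \<open>Gibbs densities and stationary solutions\<close>

locale mean_field = interaction_kernel +
  fixes \<beta> \<theta> :: real and W :: "real \<Rightarrow> real \<Rightarrow> real" and \<rho> :: "real \<times> real \<Rightarrow> real"
  assumes \<beta>_pos: "\<beta> > 0" and \<theta>_pos: "\<theta> > 0"
    and W_eq: "\<And>x y. x \<in> {0..1} \<Longrightarrow> y \<in> {0..1} \<Longrightarrow> W x y = w x y"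
    and \<rho>: "P2L_density \<rho>"
begin

lemmas \<rho>_meas[measurable] = P2L_density_facts(1)[OF \<rho>]
lemmas \<rho>_nonneg = P2L_density_facts(2)[OF \<rho>]
lemmas \<rho>_int = P2L_density_facts(3)[OF \<rho>]

lemma integral_abs_\<rho>: "(\<integral>z. \<bar>\<rho> z\<bar> \<partial>phase_measure) = 1"
proof -
  have "(\<integral>z. \<bar>\<rho> z\<bar> \<partial>phase_measure) = (\<integral>z. \<rho> z \<partial>phase_measure)"
    by (rule Bochner_Integration.integral_cong) (auto simp: \<rho>_nonneg)
  then show ?thesis using P2L_density_facts(4)[OF \<rho>] by simp
qed

definition energy :: "real \<Rightarrow> real \<Rightarrow> real" where
  "energy u x = \<beta> * \<theta> * potential \<rho> u x"

definition bound :: real where "bound = \<beta> * \<theta> * MD"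

definition partition_function :: "real \<Rightarrow> real" where
  "partition_function x = (\<integral>u. exp (- energy u x) \<partial>angle_measure)"

text \<open>It is built from the potential of the fixed \<open>\<rho>\<close>, so agreement of
  \<open>\<rho>\<close> with \<open>gibbs\<close> is a fixed-point equation.\<close>

definition gibbs :: "real \<times> real \<Rightarrow> real" where
  "gibbs z = exp (- energy (fst z) (snd z)) / partition_function (snd z)"

lemma energy_bound: "\<bar>energy u x\<bar> \<le> bound"
proof -
  have "\<bar>energy u x\<bar> = \<beta> * \<theta> * \<bar>potential \<rho> u x\<bar>"
    using \<beta>_pos \<theta>_pos by (simp add: energy_def abs_mult)
  also have "\<dots> \<le> \<beta> * \<theta> * MD"
    using potential_bound[OF \<rho>_int, of u x] \<beta>_pos \<theta>_pos by (intro mult_left_mono) (auto simp: integral_abs_\<rho>)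
  finally show ?thesis by (simp add: bound_def)
qed

lemma energy_lipschitz: "(\<beta> * \<theta> * LD)-lipschitz_on UNIV (\<lambda>u. energy u x)"
  using lipschitz_on_cmult_real[OF potential_lipschitz[OF \<rho>_int, of x], of "\<beta> * \<theta>"] \<beta>_pos \<theta>_pos
  by (simp add: energy_def integral_abs_\<rho> abs_mult)

lemma energy_meas[measurable]: "(\<lambda>u. energy u x) \<in> borel_measurable borel"
  by (rule borel_measurable_continuous_onI[OF lipschitz_on_continuous_on[OF energy_lipschitz]])

lemma energy_meas_angle[measurable]: "(\<lambda>u. energy u x) \<in> borel_measurable angle_measure"
  by (rule measurable_angle_measure) measurable

lemma energy_meas_phase[measurable]: "(\<lambda>z. energy (fst z) (snd z)) \<in> borel_measurable phase_measure"
  unfolding energy_def using potential_measurable[OF \<rho>_meas] by measurable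

lemma exp_energy_integrable: "integrable angle_measure (\<lambda>u. exp (- energy u x))"
proof (rule integrable_bounded_angle[where B = "exp bound"])
  show "\<bar>exp (- energy u x)\<bar> \<le> exp bound" for u using energy_bound[of u x] by simp
qed measurable

lemma measure_angle: "measure angle_measure (space angle_measure) = 2 * pi"
  by (simp add: measure_def emeasure_angle_measure)

lemma partition_bounds: "exp (- bound) * (2 * pi) \<le> partition_function x" "partition_function x \<le> exp bound * (2 * pi)"
proof -
  have "exp (- bound) * (2 * pi) = (\<integral>u. exp (- bound) \<partial>angle_measure)" by (simp add: measure_angle)
  also have "\<dots> \<le> partition_function x" unfolding partition_function_def
  proof (rule integral_mono[OF _ exp_energy_integrable])
    show "exp (- bound) \<le> exp (- energy u x)" for u using energy_bound[of u x] by simp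
  qed simp
  finally show "exp (- bound) * (2 * pi) \<le> partition_function x" .
  have "partition_function x \<le> (\<integral>u. exp bound \<partial>angle_measure)" unfolding partition_function_def
  proof (rule integral_mono[OF exp_energy_integrable])
    show "exp (- energy u x) \<le> exp bound" for u using energy_bound[of u x] by simp
  qed simp
  then show "partition_function x \<le> exp bound * (2 * pi)" by (simp add: measure_angle mult.commute)
qed

lemma partition_pos: "0 < partition_function x"
  using partition_bounds(1)[of x] by (rule less_le_trans[rotated]) simp

lemma partition_meas[measurable]: "partition_function \<in> borel_measurable label_measure"
proof -
  have [measurable]: "(\<lambda>z. energy (fst z) (snd z)) \<in> borel_measurable (angle_measure \<Otimes>\<^sub>M label_measure)"
    using energy_meas_phase by (simp add: phase_measure_def)
  have "(\<lambda>(x, u). energy u x) \<in> borel_measurable (label_measure \<Otimes>\<^sub>M angle_measure)"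
    using measurable_compose[OF measurable_pair_swap' \<open>(\<lambda>z. energy (fst z) (snd z)) \<in> _\<close>]
    by (simp add: case_prod_unfold)
  then show ?thesis unfolding partition_function_def
    by (intro angle.borel_measurable_lebesgue_integral) (simp add: case_prod_unfold)
qed

lemma partition_meas_phase[measurable]: "(\<lambda>z. partition_function (snd z)) \<in> borel_measurable phase_measure"
  by (rule measurable_compose[OF snd_phase_label partition_meas])

lemma gibbs_meas[measurable]: "gibbs \<in> borel_measurable phase_measure"
  unfolding gibbs_def by measurable

lemma gibbs_pos: "0 < gibbs z"
  by (simp add: gibbs_def partition_pos)

lemma ln_gibbs: "ln (gibbs z) = - energy (fst z) (snd z) - ln (partition_function (snd z))"
  using partition_pos[of "snd z"] by (simp add: gibbs_def ln_div)

lemma ln_partition_bound: "\<bar>ln (partition_function x)\<bar> \<le> bound + \<bar>ln (2 * pi)\<bar>"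
proof -
  have "ln (exp (- bound) * (2 * pi)) \<le> ln (partition_function x)" "ln (partition_function x) \<le> ln (exp bound * (2 * pi))"
    using partition_bounds[of x] partition_pos[of x] by (auto intro!: ln_mono)
  then have "- bound + ln (2 * pi) \<le> ln (partition_function x)" "ln (partition_function x) \<le> bound + ln (2 * pi)"
    by (simp_all add: ln_mult_pos)
  then show ?thesis by linarith
qed

text \<open>One \<open>bound\<close> comes from the energy and one from ln Z. Boundedness of ln g
  makes every integral against it finite and gives the Gibbs density finite entropy.\<close>

lemma ln_gibbs_bound: "\<bar>ln (gibbs z)\<bar> \<le> 2 * bound + \<bar>ln (2 * pi)\<bar>"
  using ln_partition_bound[of "snd z"] energy_bound[of "fst z" "snd z"] unfolding ln_gibbs by linarith

lemma gibbs_slice: "(\<integral>u. gibbs (u, x) \<partial>angle_measure) = 1"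
  using partition_pos[of x] by (simp add: gibbs_def partition_function_def[symmetric])

lemma gibbs_P2L: "P2L_density gibbs"
proof (rule P2L_densityI)
  fix x :: real assume "x \<in> {0..1}"
  have "integrable angle_measure (\<lambda>u. gibbs (u, x))"
    using exp_energy_integrable[of x] by (simp add: gibbs_def)
  then show "(\<integral>\<^sup>+u. ennreal (gibbs (u, x)) \<partial>angle_measure) = 1"
    using gibbs_slice[of x] by (subst nn_integral_eq_integral) (auto intro: less_imp_le gibbs_pos)
qed (auto intro: less_imp_le gibbs_pos)

lemma drift_eq:
  assumes "x \<in> {0..1}"
  shows "drift W D \<rho> u x = slope \<rho> u x"
  unfolding drift_def slope_def
  by (rule Bochner_Integration.integral_cong) (auto simp: space_phase_measure W_eq[OF assms])

text \<open>After multiplication by \<beta> the circle results apply with A the energy on this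
  slice; unit mass then fixes the free constant as 1 / Z(x).\<close>

lemma stationary_slice_iff:
  assumes x: "x \<in> {0..1}"
    and r: "integrable angle_measure (\<lambda>u. \<rho> (u, x))" "(\<integral>u. \<rho> (u, x) \<partial>angle_measure) = 1"
  shows "(\<forall>\<phi>. periodic_test_function \<phi> \<longrightarrow>
        - \<theta> * (\<integral>u. \<rho> (u, x) * drift W D \<rho> u x * deriv \<phi> u \<partial>angle_measure)
        + inverse \<beta> * (\<integral>u. \<rho> (u, x) * deriv (deriv \<phi>) u \<partial>angle_measure) = 0)
      \<longleftrightarrow> (AE u in angle_measure. \<rho> (u, x) = gibbs (u, x))"
proof -
  define a where "a u = \<beta> * \<theta> * slope \<rho> u x" for u
  have s_meas[measurable]: "(\<lambda>u. slope \<rho> u x) \<in> borel_measurable angle_measure"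
    by (rule measurable_angle_measure[OF slope_measurable[OF \<rho>_meas]])
  have s_bound: "\<bar>slope \<rho> u x\<bar> \<le> BD" for u
    using slope_bound[OF \<rho>_int, of u x] by (simp add: integral_abs_\<rho>)
  interpret C: circle_weight "\<lambda>u. \<rho> (u, x)" a "\<lambda>u. energy u x" "\<beta> * \<theta> * LD" "\<beta> * \<theta> * BD"
  proof
    show "a \<in> borel_measurable angle_measure" unfolding a_def by measurable
    show "\<bar>a u\<bar> \<le> \<beta> * \<theta> * BD" for u
      unfolding a_def using s_bound[of u] \<beta>_pos \<theta>_pos by (simp add: abs_mult)
    show "energy (u + 2 * pi) x = energy u x" for u
      by (simp add: energy_def potential_periodic[OF \<rho>_int])
    \<comment> \<open>Knowing the value of \<open>deriv\<close> alone would not exclude the default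
      value; differentiability is needed to scale the potential by \<beta>\<theta>.\<close>
    have "AE u in lborel. ((\<lambda>u. potential \<rho> u x) has_real_derivative deriv (\<lambda>u. potential \<rho> u x) u) (at u)"
      by (rule lipschitz_AE_has_deriv(1)[OF potential_lipschitz[OF \<rho>_int]])
    then have "AE u in lborel. deriv (\<lambda>u. energy u x) u = a u"
      using potential_AE_deriv[OF \<rho>_int, of x]
    proof eventually_elim
      case (elim u)
      have "((\<lambda>u. energy u x) has_real_derivative \<beta> * \<theta> * slope \<rho> u x) (at u)"
        unfolding energy_def using elim by (intro DERIV_cmult) simp
      then show ?case unfolding a_def by (rule DERIV_imp_deriv)
    qed
    then show "AE u in angle_measure. deriv (\<lambda>u. energy u x) u = a u" by (rule AE_angle_measure)
  qed (rule r(1), rule energy_lipschitz)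
  have weak: "(\<forall>\<phi>. periodic_test_function \<phi> \<longrightarrow>
        - \<theta> * (\<integral>u. \<rho> (u, x) * drift W D \<rho> u x * deriv \<phi> u \<partial>angle_measure)
        + inverse \<beta> * (\<integral>u. \<rho> (u, x) * deriv (deriv \<phi>) u \<partial>angle_measure) = 0)
      \<longleftrightarrow> weak_stationary (\<lambda>u. \<rho> (u, x)) a"
    unfolding weak_stationary_def
  proof (intro all_cong1 imp_cong refl)
    fix \<phi> assume \<phi>: "periodic_test_function \<phi>"
    note D' = periodic_test_functionD[OF \<phi>]
    obtain B1 where B1: "B1 > 0" "\<And>x. \<bar>deriv \<phi> x\<bar> \<le> B1" using periodic_bounded[OF D'(3,6)] by blast
    obtain B2 where B2: "B2 > 0" "\<And>x. \<bar>deriv (deriv \<phi>) x\<bar> \<le> B2" using periodic_bounded[OF D'(4,7)] by blast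
    have [measurable]: "deriv \<phi> \<in> borel_measurable angle_measure" "deriv (deriv \<phi>) \<in> borel_measurable angle_measure"
      using borel_measurable_continuous_onI[OF D'(3)] borel_measurable_continuous_onI[OF D'(4)]
      by (auto intro!: measurable_angle_measure)
    have i1: "integrable angle_measure (\<lambda>u. \<rho> (u, x) * slope \<rho> u x * deriv \<phi> u)"
      by (intro integrable_mult_bounded[OF _ _ B1(2)] integrable_mult_bounded[OF r(1) _ s_bound]) measurable
    have i2: "integrable angle_measure (\<lambda>u. \<rho> (u, x) * deriv (deriv \<phi>) u)"
      by (intro integrable_mult_bounded[OF r(1) _ B2(2)]) measurable
    have "(\<integral>u. \<rho> (u, x) * (deriv (deriv \<phi>) u - a u * deriv \<phi> u) \<partial>angle_measure)
        = (\<integral>u. \<rho> (u, x) * deriv (deriv \<phi>) u - \<beta> * \<theta> * (\<rho> (u, x) * slope \<rho> u x * deriv \<phi> u) \<partial>angle_measure)"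
      by (rule Bochner_Integration.integral_cong) (auto simp: a_def algebra_simps)
    also have "\<dots> = (\<integral>u. \<rho> (u, x) * deriv (deriv \<phi>) u \<partial>angle_measure)
        - \<beta> * \<theta> * (\<integral>u. \<rho> (u, x) * slope \<rho> u x * deriv \<phi> u \<partial>angle_measure)"
      using i1 i2 by (subst Bochner_Integration.integral_diff) auto
    finally have I: "(\<integral>u. \<rho> (u, x) * (deriv (deriv \<phi>) u - a u * deriv \<phi> u) \<partial>angle_measure) = \<dots>" .
    show "(- \<theta> * (\<integral>u. \<rho> (u, x) * drift W D \<rho> u x * deriv \<phi> u \<partial>angle_measure)
        + inverse \<beta> * (\<integral>u. \<rho> (u, x) * deriv (deriv \<phi>) u \<partial>angle_measure) = 0)
      \<longleftrightarrow> (\<integral>u. \<rho> (u, x) * (deriv (deriv \<phi>) u - a u * deriv \<phi> u) \<partial>angle_measure) = 0"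
      unfolding I drift_eq[OF x] using \<beta>_pos by (simp add: field_simps)
  qed
  show ?thesis unfolding weak
  proof
    assume "weak_stationary (\<lambda>u. \<rho> (u, x)) a"
    from C.weak_imp_gibbs[OF this] obtain c
      where c: "AE u in angle_measure. \<rho> (u, x) * exp (energy u x) = c" by blast
    have eq: "AE u in angle_measure. \<rho> (u, x) = c * exp (- energy u x)"
      using c
    proof eventually_elim
      case (elim u)
      have "\<rho> (u, x) = \<rho> (u, x) * exp (energy u x) * exp (- energy u x)"
        by (simp add: mult.assoc exp_add[symmetric])
      then show ?case by (simp only: elim)
    qed
    have "1 = (\<integral>u. c * exp (- energy u x) \<partial>angle_measure)"
      unfolding r(2)[symmetric] using r(1) eq by (intro integral_cong_AE) auto
    then have "c = 1 / partition_function x"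
      using partition_pos[of x] by (simp add: partition_function_def[symmetric] field_simps)
    then show "AE u in angle_measure. \<rho> (u, x) = gibbs (u, x)"
      using eq by (simp add: gibbs_def)
  next
    assume "AE u in angle_measure. \<rho> (u, x) = gibbs (u, x)"
    then show "weak_stationary (\<lambda>u. \<rho> (u, x)) a"
      by (intro C.gibbs_imp_weak[where c = "1 / partition_function x"]) (simp add: gibbs_def)
  qed
qed

lemma stationary_iff_gibbs:
  "stationary_solution \<beta> \<theta> W D \<rho> \<longleftrightarrow> (AE z in phase_measure. \<rho> z = gibbs z)"
proof -
  have "stationary_solution \<beta> \<theta> W D \<rho> \<longleftrightarrow>
      (AE x in label_measure. AE u in angle_measure. \<rho> (u, x) = gibbs (u, x))"
  proof -
    have slice: "AE x in label_measure. x \<in> {0..1} \<and> integrable angle_measure (\<lambda>u. \<rho> (u, x)) \<and>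
        (\<integral>u. \<rho> (u, x) \<partial>angle_measure) = 1"
      using P2L_density_facts(7)[OF \<rho>] AE_space[of label_measure] by eventually_elim (auto simp: space_label_measure)
    have cong: "(AE x in label_measure. P x) \<longleftrightarrow> (AE x in label_measure. Q x)"
      if "AE x in label_measure. P x \<longleftrightarrow> Q x" for P Q
      using that by (auto elim!: AE_mp)
    show ?thesis
      unfolding stationary_solution_def eqTrueI[OF \<rho>]
    proof (simp only: simp_thms, rule cong)
      show "AE x in label_measure. (\<forall>\<phi>. periodic_test_function \<phi> \<longrightarrow>
        - \<theta> * (\<integral>u. \<rho> (u, x) * drift W D \<rho> u x * deriv \<phi> u \<partial>angle_measure)
        + inverse \<beta> * (\<integral>u. \<rho> (u, x) * deriv (deriv \<phi>) u \<partial>angle_measure) = 0)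
        \<longleftrightarrow> (AE u in angle_measure. \<rho> (u, x) = gibbs (u, x))"
        using slice by eventually_elim (intro stationary_slice_iff; simp)
    qed
  qed
  also have "\<dots> \<longleftrightarrow> (AE z in phase_measure. \<rho> z = gibbs z)"
    by (rule AE_phase_iff[symmetric]) measurable
  finally show ?thesis .
qed

end

subsection \<open>Gibbs densities and critical points\<close>

text \<open>For a > 0 the expression is a (y - 1 - ln y) with y = c / a, so it reduces to ln y \<le>
  y - 1 and its equality case; for a = 0 it is c > 0. It is the gap between t ln t and its tangent
  at c, the source of all convexity estimates below.\<close>

lemma relative_entropy_nonneg:
  fixes a c :: real
  assumes "0 \<le> a" "0 < c"
  shows "0 \<le> a * ln a - a * ln c - a + c"
    and "a * ln a - a * ln c - a + c = 0 \<Longrightarrow> a = c"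
proof -
  have *: "a * ln a - a * ln c - a + c = a * ((c / a - 1) - ln (c / a))" if "a > 0"
    using that assms by (simp add: ln_div algebra_simps)
  show "0 \<le> a * ln a - a * ln c - a + c"
  proof (cases "a = 0")
    case False
    then have a: "a > 0" using assms by simp
    have "ln (c / a) \<le> c / a - 1" using a assms by (intro ln_le_minus_one) simp
    then show ?thesis unfolding *[OF a] using a by simp
  qed (use assms in simp)
  show "a = c" if 0: "a * ln a - a * ln c - a + c = 0"
  proof (cases "a = 0")
    case True
    then show ?thesis using 0 by simp
  next
    case False
    then have a: "a > 0" using assms by simp
    then have "ln (c / a) = c / a - 1" using 0 unfolding *[OF a] by simp
    then have "c / a = 1" using a assms by (intro ln_eq_minus_one) auto
    then show ?thesis using a by (simp add: field_simps)
  qed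
qed

lemma xlnx_ge: "0 \<le> t \<Longrightarrow> - 1 \<le> t * ln t" for t :: real
  using relative_entropy_nonneg(1)[of t 1] by simp

lemma xlnx_tangent: "0 \<le> a \<Longrightarrow> 0 < c \<Longrightarrow> c * ln c + (1 + ln c) * (a - c) \<le> a * ln a" for a c :: real
  using relative_entropy_nonneg(1)[of a c] by (simp add: algebra_simps)

lemma xlnx_convex:
  fixes a b s :: real
  assumes ab: "0 \<le> a" "0 \<le> b" and s: "0 \<le> s" "s \<le> 1"
  defines "c \<equiv> (1 - s) * a + s * b"
  shows "c * ln c \<le> (1 - s) * (a * ln a) + s * (b * ln b)"
proof (cases "c > 0")
  case True
  have "(1 - s) * (c * ln c + (1 + ln c) * (a - c)) + s * (c * ln c + (1 + ln c) * (b - c))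
      \<le> (1 - s) * (a * ln a) + s * (b * ln b)"
    \<comment> \<open>The tangents are taken at the convex combination c, so that their linear terms
      cancel in the weighted sum.\<close>
    using s xlnx_tangent[OF ab(1) True] xlnx_tangent[OF ab(2) True] by (intro add_mono mult_left_mono) auto
  moreover have "(1 - s) * (c * ln c + (1 + ln c) * (a - c)) + s * (c * ln c + (1 + ln c) * (b - c))
      = c * ln c + (1 + ln c) * ((1 - s) * a + s * b - c)"
    by (simp add: algebra_simps)
  ultimately show ?thesis by (simp add: c_def)
next
  case False
  have "0 \<le> (1 - s) * a" "0 \<le> s * b" using ab s by auto
  then have "(1 - s) * a = 0" "s * b = 0" "c = 0" using False unfolding c_def by linarith+
  then show ?thesis by auto
qed

lemma xlnx_deriv: "0 < t \<Longrightarrow> ((\<lambda>t. t * ln t) has_real_derivative 1 + ln t) (at t)" for t :: real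
  by (auto intro!: derivative_eq_intros)

text \<open>The negative part of t ln t is at most 1 and the phase space has finite measure, so only
  the positive part can be infinite.\<close>

lemma extended_integral_xlnx:
  assumes m[measurable]: "f \<in> borel_measurable phase_measure"
    and nn: "\<And>z. z \<in> space phase_measure \<Longrightarrow> 0 \<le> f z"
  shows "integrable phase_measure (\<lambda>z. f z * ln (f z)) \<Longrightarrow>
      extended_integral phase_measure (\<lambda>z. f z * ln (f z)) = ereal (\<integral>z. f z * ln (f z) \<partial>phase_measure)"
    and "\<not> integrable phase_measure (\<lambda>z. f z * ln (f z)) \<Longrightarrow>
      extended_integral phase_measure (\<lambda>z. f z * ln (f z)) = \<infinity>"
proof -
  let ?P = "\<integral>\<^sup>+z. ennreal (f z * ln (f z)) \<partial>phase_measure"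
  let ?N = "\<integral>\<^sup>+z. ennreal (- (f z * ln (f z))) \<partial>phase_measure"
  have "?N \<le> (\<integral>\<^sup>+z. 1 \<partial>phase_measure)"
    using xlnx_ge[OF nn] by (intro nn_integral_mono) (auto simp: ennreal_le_1)
  also have "\<dots> < \<infinity>" by (simp add: phase_space.emeasure_eq_measure)
  finally have N: "?N < \<infinity>" .
  show "extended_integral phase_measure (\<lambda>z. f z * ln (f z)) = ereal (\<integral>z. f z * ln (f z) \<partial>phase_measure)"
    if i: "integrable phase_measure (\<lambda>z. f z * ln (f z))"
  proof -
    have "?P < \<infinity>" using i by (simp add: real_integrable_def less_top)
    then show ?thesis
      using N unfolding extended_integral_def real_lebesgue_integral_def[OF i]
      by (cases ?P; cases ?N) (auto simp: enn2ereal_ennreal)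
  qed
  show "extended_integral phase_measure (\<lambda>z. f z * ln (f z)) = \<infinity>"
    if i: "\<not> integrable phase_measure (\<lambda>z. f z * ln (f z))"
  proof -
    have "?P = \<infinity>" using i N by (auto simp: real_integrable_def)
    then show ?thesis
      using N unfolding extended_integral_def by (cases ?N) (auto simp: enn2ereal_ennreal)
  qed
qed

section \<open>The interaction as a symmetric bilinear form\<close>

context interaction_kernel
begin

definition interaction :: "(real \<times> real \<Rightarrow> real) \<Rightarrow> (real \<times> real \<Rightarrow> real) \<Rightarrow> real" where
  "interaction f g = (\<integral>z. g z * potential f (fst z) (snd z) \<partial>phase_measure)"

lemma interaction_integrable:
  assumes "integrable phase_measure f" "integrable phase_measure g"
  shows "integrable phase_measure (\<lambda>z. g z * potential f (fst z) (snd z))"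
  using assms by (intro integrable_mult_bounded[OF _ potential_measurable potential_bound[OF assms(1)]]) auto

text \<open>Fubini together with symmetry of \<open>w\<close> and evenness of \<open>D\<close>.
  Along a segment this merges the two mixed terms into one with factor 2.\<close>

lemma interaction_commute:
  assumes f: "integrable phase_measure f" and g: "integrable phase_measure g"
  shows "interaction f g = interaction g f"
proof -
  interpret P: pair_sigma_finite phase_measure phase_measure ..
  have [measurable]: "f \<in> borel_measurable phase_measure" "g \<in> borel_measurable phase_measure"
    using f g by auto
  define k where "k p = w (snd (fst p)) (snd (snd p)) * D (fst (fst p) - fst (snd p))" for p :: "(real \<times> real) \<times> real \<times> real"
  have k_sym: "k (z, z') = k (z', z)" for z z'
    using D_even[of "fst z - fst z'"] w_sym[of "snd z"] by (simp add: k_def)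
  have 1: "integrable (phase_measure \<Otimes>\<^sub>M phase_measure) (\<lambda>p. g (fst p) * f (snd p))"
  proof (rule P.Fubini_integrable)
    show "integrable phase_measure (\<lambda>z. \<integral>z'. norm (g (fst (z, z')) * f (snd (z, z'))) \<partial>phase_measure)"
      using g by (simp add: abs_mult)
  qed (use f in auto)
  have [measurable]: "k \<in> borel_measurable (phase_measure \<Otimes>\<^sub>M phase_measure)"
    unfolding k_def by measurable
  have "integrable (phase_measure \<Otimes>\<^sub>M phase_measure) (\<lambda>p. g (fst p) * f (snd p) * k p)"
    by (rule integrable_mult_bounded[OF 1, where B = MD]) (auto simp: k_def wD_bound)
  then have F: "integrable (phase_measure \<Otimes>\<^sub>M phase_measure) (\<lambda>(z, z'). g z * f z' * k (z, z'))"
    by (simp add: case_prod_unfold)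
  have "interaction f g = (\<integral>z. (\<integral>z'. g z * f z' * k (z, z') \<partial>phase_measure) \<partial>phase_measure)"
    unfolding interaction_def potential_def by (simp add: k_def mult.assoc)
  also have "\<dots> = (\<integral>z'. (\<integral>z. g z * f z' * k (z, z') \<partial>phase_measure) \<partial>phase_measure)"
    using P.Fubini_integral[OF F] by simp
  also have "\<dots> = (\<integral>z'. (\<integral>z. f z' * (g z * k (z', z)) \<partial>phase_measure) \<partial>phase_measure)"
    by (intro Bochner_Integration.integral_cong refl) (simp add: k_sym mult.assoc mult.left_commute)
  also have "\<dots> = interaction g f"
    unfolding interaction_def potential_def by (simp add: k_def)
  finally show ?thesis .
qed

lemma potential_add_scale:
  assumes f: "integrable phase_measure f" and h: "integrable phase_measure h"
  shows "potential (\<lambda>z. f z + s * h z) u x = potential f u x + s * potential h u x"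
proof -
  have "potential (\<lambda>z. f z + s * h z) u x
      = (\<integral>z. f z * (w x (snd z) * D (u - fst z)) + s * (h z * (w x (snd z) * D (u - fst z))) \<partial>phase_measure)"
    unfolding potential_def by (rule Bochner_Integration.integral_cong) (auto simp: algebra_simps)
  then show ?thesis
    unfolding potential_def using potential_integrable[OF f] potential_integrable[OF h] by simp
qed

lemma interaction_expand:
  assumes f: "integrable phase_measure f" and h: "integrable phase_measure h"
  shows "interaction (\<lambda>z. f z + s * h z) (\<lambda>z. f z + s * h z)
    = interaction f f + 2 * s * interaction f h + s\<^sup>2 * interaction h h"
proof -
  note i = interaction_integrable[OF f f] interaction_integrable[OF f h]
    interaction_integrable[OF h f] interaction_integrable[OF h h]
  have "interaction (\<lambda>z. f z + s * h z) (\<lambda>z. f z + s * h z)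
    = (\<integral>z. f z * potential f (fst z) (snd z) + (s * (h z * potential f (fst z) (snd z))
        + (s * (f z * potential h (fst z) (snd z)) + s\<^sup>2 * (h z * potential h (fst z) (snd z)))) \<partial>phase_measure)"
    unfolding interaction_def potential_add_scale[OF f h]
    by (rule Bochner_Integration.integral_cong) (auto simp: algebra_simps power2_eq_square)
  also have "\<dots> = interaction f f + (s * interaction f h + (s * interaction h f + s\<^sup>2 * interaction h h))"
    unfolding interaction_def using i by simp
  finally show ?thesis using interaction_commute[OF h f] by simp
qed

end

context mean_field
begin

lemma interaction_eq:
  assumes f: "integrable phase_measure f"
  shows "(\<integral>(v, y). (\<integral>(u, x). W x y * D (u - v) * f (u, x) * f (v, y) \<partial>phase_measure) \<partial>phase_measure)
    = interaction f f"
  unfolding interaction_def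
proof (rule Bochner_Integration.integral_cong[OF refl])
  fix z assume "z \<in> space phase_measure"
  then have y: "snd z \<in> {0..1}" by (auto simp: space_phase_measure)
  have "(\<integral>(u, x). W x (snd z) * D (u - fst z) * f (u, x) * f z \<partial>phase_measure)
      = (\<integral>z'. f z * (f z' * (w (snd z) (snd z') * D (fst z - fst z'))) \<partial>phase_measure)"
  proof (rule Bochner_Integration.integral_cong[OF refl])
    fix z' assume "z' \<in> space phase_measure"
    then have "snd z' \<in> {0..1}" by (auto simp: space_phase_measure)
    then show "(case z' of (u, x) \<Rightarrow> W x (snd z) * D (u - fst z) * f (u, x) * f z)
      = f z * (f z' * (w (snd z) (snd z') * D (fst z - fst z')))"
      using W_eq[of "snd z'" "snd z"] y w_sym[of "snd z"] D_even[of "fst z - fst z'"]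
      by (simp add: case_prod_unfold)
  qed
  also have "\<dots> = f z * potential f (fst z) (snd z)" by (simp add: potential_def)
  finally show "(case z of (v, y) \<Rightarrow> \<integral>(u, x). W x y * D (u - v) * f (u, x) * f (v, y) \<partial>phase_measure)
      = f z * potential f (fst z) (snd z)"
    by (simp add: case_prod_unfold)
qed

text \<open>The interaction term is always real, so the entropy alone decides.\<close>

lemma free_energy_finite_iff:
  assumes m: "f \<in> borel_measurable phase_measure" and nn: "\<And>z. z \<in> space phase_measure \<Longrightarrow> 0 \<le> f z"
  shows "free_energy \<beta> \<theta> W D f < \<infinity> \<longleftrightarrow> integrable phase_measure (\<lambda>z. f z * ln (f z))"
  using extended_integral_xlnx[OF m nn] \<beta>_pos
  by (cases "integrable phase_measure (\<lambda>z. f z * ln (f z))") (auto simp: free_energy_def)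

lemma free_energy_eq:
  assumes f: "integrable phase_measure f" and nn: "\<And>z. z \<in> space phase_measure \<Longrightarrow> 0 \<le> f z"
    and i: "integrable phase_measure (\<lambda>z. f z * ln (f z))"
  shows "free_energy \<beta> \<theta> W D f
    = ereal (inverse \<beta> * (\<integral>z. f z * ln (f z) \<partial>phase_measure) + \<theta> / 2 * interaction f f)"
  using extended_integral_xlnx(1)[OF _ nn i] f by (simp add: free_energy_def interaction_eq[OF f])

text \<open>On the segment c ln c lies between -1 and the convex combination of the end values,
  which bounds it by an integrable function. The interaction is an exact quadratic polynomial in
  s.\<close>

lemma segment_entropy:
  assumes \<rho>1: "P2L_density \<rho>1"
    and i: "integrable phase_measure (\<lambda>z. \<rho> z * ln (\<rho> z))"
    and i1: "integrable phase_measure (\<lambda>z. \<rho>1 z * ln (\<rho>1 z))"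
    and s: "s \<in> {0..1}"
  defines "c \<equiv> \<lambda>z. (1 - s) * \<rho> z + s * \<rho>1 z"
  shows "integrable phase_measure (\<lambda>z. c z * ln (c z))"
    and "real_of_ereal (free_energy \<beta> \<theta> W D c) = inverse \<beta> * (\<integral>z. c z * ln (c z) \<partial>phase_measure)
      + \<theta> / 2 * (interaction \<rho> \<rho> + 2 * s * interaction \<rho> (\<lambda>z. \<rho>1 z - \<rho> z)
      + s\<^sup>2 * interaction (\<lambda>z. \<rho>1 z - \<rho> z) (\<lambda>z. \<rho>1 z - \<rho> z))"
proof -
  note f1 = P2L_density_facts[OF \<rho>1]
  have [measurable]: "\<rho>1 \<in> borel_measurable phase_measure" by (rule f1(1))
  have [measurable]: "c \<in> borel_measurable phase_measure" unfolding c_def by measurable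
  have nn: "0 \<le> c z" if "z \<in> space phase_measure" for z
    using \<rho>_nonneg[OF that] f1(2)[OF that] s by (simp add: c_def)
  show ci: "integrable phase_measure (\<lambda>z. c z * ln (c z))"
  proof (rule Bochner_Integration.integrable_bound)
    show "integrable phase_measure (\<lambda>z. 1 + (\<bar>\<rho> z * ln (\<rho> z)\<bar> + \<bar>\<rho>1 z * ln (\<rho>1 z)\<bar>))"
      using i i1 by auto
    show "AE z in phase_measure. norm (c z * ln (c z)) \<le> norm (1 + (\<bar>\<rho> z * ln (\<rho> z)\<bar> + \<bar>\<rho>1 z * ln (\<rho>1 z)\<bar>))"
    proof (rule AE_I2)
      fix z assume z: "z \<in> space phase_measure"
      have "c z * ln (c z) \<le> (1 - s) * (\<rho> z * ln (\<rho> z)) + s * (\<rho>1 z * ln (\<rho>1 z))"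
        unfolding c_def using \<rho>_nonneg[OF z] f1(2)[OF z] s by (intro xlnx_convex) auto
      also have "\<dots> \<le> \<bar>\<rho> z * ln (\<rho> z)\<bar> + \<bar>\<rho>1 z * ln (\<rho>1 z)\<bar>"
      proof -
        have le: "t * x \<le> \<bar>x\<bar>" if "0 \<le> t" "t \<le> 1" for t x :: real
        proof -
          have "t * x \<le> t * \<bar>x\<bar>" using that by (intro mult_left_mono) auto
          also have "\<dots> \<le> \<bar>x\<bar>" using that by (intro mult_left_le_one_le) auto
          finally show ?thesis .
        qed
        show ?thesis using s by (intro add_mono le) auto
      qed
      finally show "norm (c z * ln (c z)) \<le> norm (1 + (\<bar>\<rho> z * ln (\<rho> z)\<bar> + \<bar>\<rho>1 z * ln (\<rho>1 z)\<bar>))"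
        using xlnx_ge[OF nn[OF z]] by simp
    qed
  qed measurable
  have c_int: "integrable phase_measure c" unfolding c_def using \<rho>_int f1(3) by auto
  have h: "integrable phase_measure (\<lambda>z. \<rho>1 z - \<rho> z)" using \<rho>_int f1(3) by auto
  have "c = (\<lambda>z. \<rho> z + s * (\<rho>1 z - \<rho> z))" unfolding c_def by (auto simp: algebra_simps)
  then have "interaction c c = interaction \<rho> \<rho> + 2 * s * interaction \<rho> (\<lambda>z. \<rho>1 z - \<rho> z)
      + s\<^sup>2 * interaction (\<lambda>z. \<rho>1 z - \<rho> z) (\<lambda>z. \<rho>1 z - \<rho> z)"
    using interaction_expand[OF \<rho>_int h, of s] by simp
  then show "real_of_ereal (free_energy \<beta> \<theta> W D c) = inverse \<beta> * (\<integral>z. c z * ln (c z) \<partial>phase_measure)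
      + \<theta> / 2 * (interaction \<rho> \<rho> + 2 * s * interaction \<rho> (\<lambda>z. \<rho>1 z - \<rho> z)
      + s\<^sup>2 * interaction (\<lambda>z. \<rho>1 z - \<rho> z) (\<lambda>z. \<rho>1 z - \<rho> z))"
    by (simp add: free_energy_eq[OF c_int nn ci])
qed

text \<open>Since ln g is minus the energy minus ln Z(x), and \<open>\<rho>\<close> and
  \<open>\<rho>1\<close> have the same label marginal, the term with Z integrates to 0 against their
  difference.\<close>

lemma integral_ln_gibbs:
  assumes \<rho>1: "P2L_density \<rho>1"
  shows "integrable phase_measure (\<lambda>z. (\<rho>1 z - \<rho> z) * ln (gibbs z))"
    and "(\<integral>z. (\<rho>1 z - \<rho> z) * ln (gibbs z) \<partial>phase_measure) = - \<beta> * \<theta> * interaction \<rho> (\<lambda>z. \<rho>1 z - \<rho> z)"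
proof -
  note f1 = P2L_density_facts[OF \<rho>1]
  have h: "integrable phase_measure (\<lambda>z. \<rho>1 z - \<rho> z)" using \<rho>_int f1(3) by auto
  show "integrable phase_measure (\<lambda>z. (\<rho>1 z - \<rho> z) * ln (gibbs z))"
    by (rule integrable_mult_bounded[OF h _ ln_gibbs_bound]) measurable
  have lZ: "integrable label_measure (\<lambda>x. ln (partition_function x))"
    by (rule label.integrable_const_bound[of _ "bound + \<bar>ln (2 * pi)\<bar>"]) (use ln_partition_bound in auto)
  note z1 = f1(5)[OF lZ] f1(6)[OF lZ] P2L_density_facts(5)[OF \<rho> lZ] P2L_density_facts(6)[OF \<rho> lZ]
  have "(\<integral>z. (\<rho>1 z - \<rho> z) * ln (gibbs z) \<partial>phase_measure)
     = (\<integral>z. - (\<beta> * \<theta>) * ((\<rho>1 z - \<rho> z) * potential \<rho> (fst z) (snd z))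
         - (\<rho>1 z * ln (partition_function (snd z)) - \<rho> z * ln (partition_function (snd z))) \<partial>phase_measure)"
    by (rule Bochner_Integration.integral_cong) (auto simp: ln_gibbs energy_def algebra_simps)
  also have "\<dots> = - (\<beta> * \<theta>) * interaction \<rho> (\<lambda>z. \<rho>1 z - \<rho> z)"
    using z1 interaction_integrable[OF \<rho>_int h] by (simp add: interaction_def)
  finally show "(\<integral>z. (\<rho>1 z - \<rho> z) * ln (gibbs z) \<partial>phase_measure) = - \<beta> * \<theta> * interaction \<rho> (\<lambda>z. \<rho>1 z - \<rho> z)"
    by simp
qed

lemma gibbs_entropy_integrable: "integrable phase_measure (\<lambda>z. gibbs z * ln (gibbs z))"
  by (rule integrable_mult_bounded[OF P2L_density_facts(3)[OF gibbs_P2L] _ ln_gibbs_bound]) measurable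

text \<open>The difference quotients are squeezed between the tangent slope \<open>l\<close> at
  \<open>\<rho>\<close>, available as Gibbs densities are positive, and the chord slope from
  convexity. Both are integrable and independent of s, so dominated convergence applies.\<close>

lemma entropy_right_derivative:
  assumes gibbs: "AE z in phase_measure. \<rho> z = gibbs z"
    and \<rho>1: "P2L_density \<rho>1"
    and i: "integrable phase_measure (\<lambda>z. \<rho> z * ln (\<rho> z))"
    and i1: "integrable phase_measure (\<lambda>z. \<rho>1 z * ln (\<rho>1 z))"
  defines "c \<equiv> \<lambda>s z. (1 - s) * \<rho> z + s * \<rho>1 z"
  shows "((\<lambda>s. \<integral>z. c s z * ln (c s z) \<partial>phase_measure)
    has_real_derivative - \<beta> * \<theta> * interaction \<rho> (\<lambda>z. \<rho>1 z - \<rho> z)) (at 0 within {0..1})"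
proof -
  note f1 = P2L_density_facts[OF \<rho>1]
  note ci = segment_entropy(1)[OF \<rho>1 i i1, folded c_def]
  have [measurable]: "\<rho>1 \<in> borel_measurable phase_measure" by (rule f1(1))
  have [measurable]: "c s \<in> borel_measurable phase_measure" for s unfolding c_def by measurable
  define l where "l z = (1 + ln (gibbs z)) * (\<rho>1 z - \<rho> z)" for z
  define q where "q s z = (c s z * ln (c s z) - \<rho> z * ln (\<rho> z)) / s" for s z
  have l_int: "integrable phase_measure l"
  proof -
    have "integrable phase_measure (\<lambda>z. (\<rho>1 z - \<rho> z) + (\<rho>1 z - \<rho> z) * ln (gibbs z))"
      using integral_ln_gibbs(1)[OF \<rho>1] \<rho>_int f1(3) by (intro Bochner_Integration.integrable_add) auto
    moreover have "l = (\<lambda>z. (\<rho>1 z - \<rho> z) + (\<rho>1 z - \<rho> z) * ln (gibbs z))"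
      by (auto simp: l_def algebra_simps)
    ultimately show ?thesis by simp
  qed
  \<comment> \<open>The 1 in 1 + ln g contributes nothing because \<open>\<rho>\<close> and
    \<open>\<rho>1\<close> have equal total mass.\<close>
  have "(\<integral>z. l z \<partial>phase_measure) = (\<integral>z. (\<rho>1 z - \<rho> z) + (\<rho>1 z - \<rho> z) * ln (gibbs z) \<partial>phase_measure)"
    unfolding l_def by (rule Bochner_Integration.integral_cong) (auto simp: algebra_simps)
  also have "\<dots> = (\<integral>z. \<rho>1 z - \<rho> z \<partial>phase_measure) + (\<integral>z. (\<rho>1 z - \<rho> z) * ln (gibbs z) \<partial>phase_measure)"
    using \<rho>_int f1(3) integral_ln_gibbs(1)[OF \<rho>1] by (intro Bochner_Integration.integral_add) auto
  also have "(\<integral>z. \<rho>1 z - \<rho> z \<partial>phase_measure) = 0"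
    using \<rho>_int f1(3,4) P2L_density_facts(4)[OF \<rho>] by simp
  finally have l_eq: "(\<integral>z. l z \<partial>phase_measure) = - \<beta> * \<theta> * interaction \<rho> (\<lambda>z. \<rho>1 z - \<rho> z)"
    using integral_ln_gibbs(2)[OF \<rho>1] by simp
  have lim: "(\<lambda>n. \<integral>z. q (X n) z \<partial>phase_measure) \<longlonglongrightarrow> (\<integral>z. l z \<partial>phase_measure)"
    if X: "\<And>n. X n \<in> {0..1} - {0}" "X \<longlonglongrightarrow> 0" for X :: "nat \<Rightarrow> real"
  proof (rule integral_dominated_convergence[where w = "\<lambda>z. \<bar>l z\<bar> + (\<bar>\<rho>1 z * ln (\<rho>1 z)\<bar> + \<bar>\<rho> z * ln (\<rho> z)\<bar>)"])
    show "integrable phase_measure (\<lambda>z. \<bar>l z\<bar> + (\<bar>\<rho>1 z * ln (\<rho>1 z)\<bar> + \<bar>\<rho> z * ln (\<rho> z)\<bar>))"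
      using l_int i i1 by auto
    show "AE z in phase_measure. (\<lambda>n. q (X n) z) \<longlonglongrightarrow> l z"
      using gibbs
    proof eventually_elim
      case (elim z)
      have 1: "((\<lambda>s. c s z) has_real_derivative (\<rho>1 z - \<rho> z)) (at 0)"
        unfolding c_def by (auto intro!: derivative_eq_intros)
      have 2: "((\<lambda>t. t * ln t) has_real_derivative 1 + ln (gibbs z)) (at (c 0 z))"
        using xlnx_deriv[OF gibbs_pos[of z]] elim by (simp add: c_def)
      have "((\<lambda>s. c s z * ln (c s z)) has_real_derivative l z) (at 0)"
        unfolding l_def by (rule DERIV_chain2[OF 2 1])
      then have "((\<lambda>s. q s z) \<longlongrightarrow> l z) (at 0)"
        unfolding has_field_derivative_iff q_def by (simp add: c_def)
      then show ?case
        by (rule filterlim_compose) (use X in \<open>auto simp: filterlim_at\<close>)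
    qed
    show "AE z in phase_measure. norm (q (X n) z) \<le> \<bar>l z\<bar> + (\<bar>\<rho>1 z * ln (\<rho>1 z)\<bar> + \<bar>\<rho> z * ln (\<rho> z)\<bar>)" for n
      using gibbs AE_space
    proof eventually_elim
      case (elim z)
      define s where "s = X n"
      have s: "0 < s" "s \<le> 1" using X(1)[of n] by (auto simp: s_def)
      have nn: "0 \<le> \<rho> z" "0 \<le> \<rho>1 z" using \<rho>_nonneg[OF elim(2)] f1(2)[OF elim(2)] .
      have up: "q s z \<le> \<rho>1 z * ln (\<rho>1 z) - \<rho> z * ln (\<rho> z)"
      proof -
        have "c s z * ln (c s z) \<le> (1 - s) * (\<rho> z * ln (\<rho> z)) + s * (\<rho>1 z * ln (\<rho>1 z))"
          using xlnx_convex[OF nn, of s] s by (simp add: c_def)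
        then have "c s z * ln (c s z) - \<rho> z * ln (\<rho> z) \<le> (\<rho>1 z * ln (\<rho>1 z) - \<rho> z * ln (\<rho> z)) * s"
          by (simp add: algebra_simps)
        then show ?thesis using s by (simp add: q_def pos_divide_le_eq)
      qed
      have "0 \<le> c s z" using nn s by (simp add: c_def)
      moreover have "0 < \<rho> z" using elim gibbs_pos by simp
      ultimately have "\<rho> z * ln (\<rho> z) + (1 + ln (\<rho> z)) * (c s z - \<rho> z) \<le> c s z * ln (c s z)"
        by (rule xlnx_tangent)
      moreover have "(1 + ln (\<rho> z)) * (c s z - \<rho> z) = s * l z"
        using elim by (simp add: l_def c_def algebra_simps)
      ultimately have low: "l z \<le> q s z"
        using s unfolding q_def by (simp add: pos_le_divide_eq mult.commute)
      show ?case using up low unfolding s_def[symmetric] by simp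
    qed
    show "l \<in> borel_measurable phase_measure" using l_int by auto
    show "q (X n) \<in> borel_measurable phase_measure" for n unfolding q_def by measurable
  qed
  have q_eq: "(\<integral>z. q s z \<partial>phase_measure)
      = ((\<integral>z. c s z * ln (c s z) \<partial>phase_measure) - (\<integral>z. c 0 z * ln (c 0 z) \<partial>phase_measure)) / (s - 0)"
    if "s \<in> {0..1}" for s
    using ci[OF that] i unfolding q_def by (simp add: c_def)
  \<comment> \<open>Dominated convergence speaks of sequences, so the one-sided limit is tested
    along arbitrary sequences of nonzero points of the unit interval.\<close>
  show ?thesis
    unfolding has_field_derivative_iff tendsto_at_iff_sequentially l_eq[symmetric]
  proof (intro allI impI)
    fix X :: "nat \<Rightarrow> real" assume X: "\<forall>n. X n \<in> {0..1} - {0}" "X \<longlonglongrightarrow> 0"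
    then have "\<And>n. X n \<in> {0..1}" by auto
    with lim[of X] X q_eq
    show "((\<lambda>y. ((\<integral>z. c y z * ln (c y z) \<partial>phase_measure) - (\<integral>z. c 0 z * ln (c 0 z) \<partial>phase_measure)) / (y - 0)) \<circ> X)
        \<longlonglongrightarrow> (\<integral>z. l z \<partial>phase_measure)"
      by (simp add: o_def)
  qed
qed

lemma gibbs_imp_critical:
  assumes gibbs: "AE z in phase_measure. \<rho> z = gibbs z"
  shows "critical_point \<beta> \<theta> W D \<rho>"
proof -
  have i: "integrable phase_measure (\<lambda>z. \<rho> z * ln (\<rho> z))"
    by (rule integrable_cong_AE_imp[OF gibbs_entropy_integrable])
      (use gibbs in \<open>auto elim!: eventually_mono\<close>)
  show ?thesis
    unfolding critical_point_def
  proof (intro conjI allI impI \<rho>)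
    show "free_energy \<beta> \<theta> W D \<rho> < \<infinity>" using free_energy_finite_iff[OF \<rho>_meas \<rho>_nonneg] i by simp
    fix \<rho>1 assume "P2L_density \<rho>1 \<and> free_energy \<beta> \<theta> W D \<rho>1 < \<infinity>"
    then have \<rho>1: "P2L_density \<rho>1" and fin: "free_energy \<beta> \<theta> W D \<rho>1 < \<infinity>" by auto
    have i1: "integrable phase_measure (\<lambda>z. \<rho>1 z * ln (\<rho>1 z))"
      using free_energy_finite_iff[OF P2L_density_facts(1)[OF \<rho>1] P2L_density_facts(2)[OF \<rho>1]] fin by blast
    let ?h = "\<lambda>z. \<rho>1 z - \<rho> z"
    let ?c = "\<lambda>s z. (1 - s) * \<rho> z + s * \<rho>1 z"
    have "((\<lambda>s. inverse \<beta> * (\<integral>z. ?c s z * ln (?c s z) \<partial>phase_measure)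
        + \<theta> / 2 * (interaction \<rho> \<rho> + 2 * s * interaction \<rho> ?h + s\<^sup>2 * interaction ?h ?h))
        has_real_derivative inverse \<beta> * (- \<beta> * \<theta> * interaction \<rho> ?h) + \<theta> / 2 * (2 * interaction \<rho> ?h))
        (at 0 within {0..1})"
      by (intro DERIV_add DERIV_cmult entropy_right_derivative[OF gibbs \<rho>1 i i1])
        (auto intro!: derivative_eq_intros)
    \<comment> \<open>The entropy contributes -\<theta> J and the interaction \<theta> J, where J is
      the mixed term; its factor 2 cancels the 1/2 in the energy.\<close>
    also have "inverse \<beta> * (- \<beta> * \<theta> * interaction \<rho> ?h) + \<theta> / 2 * (2 * interaction \<rho> ?h) = 0"
      using \<beta>_pos by (simp add: field_simps)
    finally show "((\<lambda>s. real_of_ereal (free_energy \<beta> \<theta> W D (?c s))) has_real_derivative 0) (at 0 within {0..1})"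
      by (rule has_field_derivative_transform_within[OF _ zero_less_one])
        (auto simp: segment_entropy(2)[OF \<rho>1 i i1])
  qed
qed

lemma critical_imp_gibbs:
  assumes crit: "critical_point \<beta> \<theta> W D \<rho>"
  shows "AE z in phase_measure. \<rho> z = gibbs z"
proof -
  have i: "integrable phase_measure (\<lambda>z. \<rho> z * ln (\<rho> z))"
    using crit free_energy_finite_iff[OF \<rho>_meas \<rho>_nonneg] unfolding critical_point_def by simp
  note i1 = gibbs_entropy_integrable and f1 = P2L_density_facts[OF gibbs_P2L]
  let ?h = "\<lambda>z. gibbs z - \<rho> z"
  let ?c = "\<lambda>s z. (1 - s) * \<rho> z + s * gibbs z"
  define E where "E s = real_of_ereal (free_energy \<beta> \<theta> W D (?c s))" for s
  have "free_energy \<beta> \<theta> W D gibbs < \<infinity>"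
    using free_energy_finite_iff[OF f1(1,2)] i1 by simp
  then have deriv: "(E has_real_derivative 0) (at 0 within {0..1})"
    using crit gibbs_P2L unfolding critical_point_def E_def by blast
  define H H1 where "H = (\<integral>z. \<rho> z * ln (\<rho> z) \<partial>phase_measure)" and "H1 = (\<integral>z. gibbs z * ln (gibbs z) \<partial>phase_measure)"
  define J1 J2 where "J1 = interaction \<rho> ?h" and "J2 = interaction ?h ?h"
  \<comment> \<open>An upper bound for the derivative towards \<open>gibbs\<close>: the chord slope
    of the entropy plus the exact slope of the interaction. It equals minus 1/\<beta> times the
    relative entropy of \<open>\<rho>\<close> with respect to \<open>gibbs\<close>.\<close>
  define d where "d = inverse \<beta> * (H1 - H) + \<theta> * J1"
  \<comment> \<open>Convexity bounds the entropy by its chord; the quadratic interaction leaves a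
    remainder linear in s, which disappears in the limit.\<close>
  have quot: "(E s - E 0) / (s - 0) \<le> d + \<theta> / 2 * J2 * s" if s: "0 < s" "s \<le> 1" for s
  proof -
    have s01: "s \<in> {0..1}" using s by simp
    have "(\<integral>z. ?c s z * ln (?c s z) \<partial>phase_measure)
        \<le> (\<integral>z. (1 - s) * (\<rho> z * ln (\<rho> z)) + s * (gibbs z * ln (gibbs z)) \<partial>phase_measure)"
    proof (rule integral_mono[OF segment_entropy(1)[OF gibbs_P2L i i1 s01]])
      show "?c s z * ln (?c s z) \<le> (1 - s) * (\<rho> z * ln (\<rho> z)) + s * (gibbs z * ln (gibbs z))"
        if "z \<in> space phase_measure" for z
        using \<rho>_nonneg[OF that] f1(2)[OF that] s by (intro xlnx_convex) auto
    qed (use i i1 in auto)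
    also have "\<dots> = H + s * (H1 - H)" using i i1 by (simp add: H_def H1_def algebra_simps)
    finally have "inverse \<beta> * (\<integral>z. ?c s z * ln (?c s z) \<partial>phase_measure) \<le> inverse \<beta> * (H + s * (H1 - H))"
      using \<beta>_pos by (intro mult_left_mono) auto
    moreover have "E s = inverse \<beta> * (\<integral>z. ?c s z * ln (?c s z) \<partial>phase_measure)
        + \<theta> / 2 * (interaction \<rho> \<rho> + 2 * s * J1 + s\<^sup>2 * J2)"
      unfolding E_def J1_def J2_def by (rule segment_entropy(2)[OF gibbs_P2L i i1 s01])
    moreover have "E 0 = inverse \<beta> * H + \<theta> / 2 * interaction \<rho> \<rho>"
      unfolding E_def H_def using segment_entropy(2)[OF gibbs_P2L i i1, of 0] by simp
    ultimately have "E s - E 0 \<le> s * (d + \<theta> / 2 * J2 * s)"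
      by (simp add: d_def algebra_simps power2_eq_square)
    then show ?thesis using s by (simp add: pos_divide_le_eq mult.commute)
  qed
  have "0 \<le> d"
  proof (rule tendsto_le)
    show "((\<lambda>s. (E s - E 0) / (s - 0)) \<longlongrightarrow> 0) (at 0 within {0..1})"
      using deriv by (simp only: has_field_derivative_iff)
    have "((\<lambda>s. d + \<theta> / 2 * J2 * s) \<longlongrightarrow> d + \<theta> / 2 * J2 * 0) (at 0 within {0..1})"
      by (intro tendsto_intros)
    then show "((\<lambda>s. d + \<theta> / 2 * J2 * s) \<longlongrightarrow> d) (at 0 within {0..1})" by simp
    show "\<forall>\<^sub>F s in at 0 within {0..1}. (E s - E 0) / (s - 0) \<le> d + \<theta> / 2 * J2 * s"
      using quot by (auto simp: eventually_at_filter intro!: always_eventually)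
    show "at (0::real) within {0..1} \<noteq> bot" by (simp add: trivial_limit_within islimpt_Icc)
  qed
  then have d0: "H - H1 - \<beta> * \<theta> * J1 \<le> 0"
    using \<beta>_pos by (simp add: d_def field_simps)
  \<comment> \<open>The relative entropy integrand, made pointwise nonnegative by adding g - \<rho>,
    whose integral is 0 because both have mass 1.\<close>
  define K where "K z = \<rho> z * ln (\<rho> z) - \<rho> z * ln (gibbs z) - \<rho> z + gibbs z" for z
  have K_eq: "K = (\<lambda>z. \<rho> z * ln (\<rho> z) - gibbs z * ln (gibbs z) + (?h z * ln (gibbs z)) + ?h z)"
    by (auto simp: K_def algebra_simps)
  have K_int: "integrable phase_measure K"
    unfolding K_eq using i i1 integral_ln_gibbs(1)[OF gibbs_P2L] \<rho>_int f1(3) by auto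
  have "(\<integral>z. K z \<partial>phase_measure) = H - H1 - \<beta> * \<theta> * J1"
    unfolding K_eq H_def H1_def J1_def
    using i i1 integral_ln_gibbs[OF gibbs_P2L] \<rho>_int f1(3,4) P2L_density_facts(4)[OF \<rho>]
    by (simp del: left_diff_distrib)
  moreover have K_nn: "AE z in phase_measure. 0 \<le> K z"
    unfolding K_def by (intro AE_I2 relative_entropy_nonneg \<rho>_nonneg gibbs_pos)
  ultimately have "(\<integral>z. K z \<partial>phase_measure) = 0"
    using d0 integral_nonneg_AE[OF K_nn] by simp
  then have "AE z in phase_measure. K z = 0"
    using integral_nonneg_eq_0_iff_AE[OF K_int K_nn] by simp
  then show ?thesis
    using AE_space
  proof eventually_elim
    case (elim z)
    show ?case
      by (rule relative_entropy_nonneg(2)[OF \<rho>_nonneg[OF elim(2)] gibbs_pos]) (use elim(1) in \<open>simp add: K_def\<close>)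
  qed
qed

lemma stationary_iff_critical: "stationary_solution \<beta> \<theta> W D \<rho> \<longleftrightarrow> critical_point \<beta> \<theta> W D \<rho>"
  using stationary_iff_gibbs gibbs_imp_critical critical_imp_gibbs by blast

end

theorem proposition2p1:
  fixes \<beta> \<theta> :: real
    and W :: "real \<Rightarrow> real \<Rightarrow> real"
    and D :: "real \<Rightarrow> real"
    and \<rho> :: "real \<times> real \<Rightarrow> real"
  assumes "\<beta> > 0" and "\<theta> > 0"
    and "admissible_kernel W"
    and "admissible_potential D"
    and "P2L_density \<rho>"
  shows "stationary_solution \<beta> \<theta> W D \<rho> \<longleftrightarrow> critical_point \<beta> \<theta> W D \<rho>"
proof -
  obtain L where D: "L-lipschitz_on UNIV D" "\<And>u. D (- u) = D u" "\<And>u. D (u + 2 * pi) = D u"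
    using \<open>admissible_potential D\<close> unfolding admissible_potential_def by blast
  note W = \<open>admissible_kernel W\<close>[unfolded admissible_kernel_def]
  let ?S = "{0..1} \<times> {0..1} :: (real \<times> real) set"
  \<comment> \<open>The extension of \<open>W\<close> by 0 required by the locale; values off the
    unit square never enter the integrals.\<close>
  define w where "w x y = indicator ?S (x, y) * W x y" for x y
  have S: "?S \<in> sets borel" by (intro borel_closed closed_Times) auto
  have "(\<lambda>p. indicator ?S p *\<^sub>R (case p of (x, y) \<Rightarrow> W x y)) \<in> borel_measurable borel"
    using W S by (subst borel_measurable_restrict_space_iff[symmetric]) auto
  then have w_meas: "(\<lambda>(x, y). w x y) \<in> borel_measurable (borel \<Otimes>\<^sub>M borel)"
    by (simp add: w_def case_prod_unfold borel_prod)
  interpret mean_field w D L \<beta> \<theta> W \<rho>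
  proof
    show "0 \<le> w x y" "w x y \<le> 1" "w x y = w y x" for x y
      using W by (auto simp: w_def indicator_def)
    show "W x y = w x y" if "x \<in> {0..1}" "y \<in> {0..1}" for x y
      using that by (simp add: w_def)
  qed (use assms D w_meas in auto)
  show ?thesis by (rule stationary_iff_critical)
qed

end
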